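(* Let $K$ be an algebraically closed field of characteristic zero and let $m\ge 1$ be an integer. Any artinian Gorenstein standard graded $K$-algebra $A$ of odd socle degree $d=2m+1$ with $h$-vector $$(1,4,6,8,10,\dots,2m,2m+2,2m+2,2m,\dots,10,8,6,4,1),$$ i.e. $h_0=1$, $h_i=2i+2$ for $1\le i\le m$, and $h_{2m+1-i}=h_i$ for $0\le i\le m$, satisfies the weak Lefschetz property.
   Context: A standard graded artinian $K$-algebra is $A=R/I$ with $R=K[x_1,\dots,x_n]$ (standard grading) and $I$ a homogeneous ideal such that $\dim_K A<\infty$. Its $h$-vector is $(h_0,\dots,h_d)$ with $h_i=\dim_K[A]_i>0$ for $0\le i\le d$, where $d$ is the largest degree in which $A$ is nonzero; $d$ is called the socle degree. $A$ is Gorenstein if its socle is one-dimensional, concentrated in degree $d$ (then its $h$-vector is symmetric). $A$ has the weak Lefschetz property (WLP) if there is a linear form $\ell\in[A]_1$ such that for every integer $i\ge 0$ the multiplication map $\times\ell\colon[A]_i\to[A]_{i+1}$ has maximal rank (i.e. is injective or surjective). *)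

theory Defs
  imports "HOL-Algebra.Algebraic_Closure_Type" "HOL-Library.Poly_Mapping"
begin

text \<open>
  Polynomials over \<open>'k\<close> in the finitely many variables \<open>'x\<close>: exponent vectors are finitely
  supported functions \<open>'x \<Rightarrow> nat\<close>, and a polynomial is a finitely supported function from
  exponent vectors to coefficients, multiplied by convolution.
\<close>

type_synonym ('x, 'k) mpoly = "('x \<Rightarrow>\<^sub>0 nat) \<Rightarrow>\<^sub>0 'k"

abbreviation poly_ring :: "('x::finite, 'k::field) mpoly ring" where
  "poly_ring \<equiv> ring_of_type_algebra"

definition mon_degree :: "('x::finite \<Rightarrow>\<^sub>0 nat) \<Rightarrow> nat" where
  "mon_degree t = (\<Sum>x\<in>UNIV. Poly_Mapping.lookup t x)"

definition forms :: "nat \<Rightarrow> ('x::finite, 'k::field) mpoly set" where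
  "forms i = {f. \<forall>t\<in>Poly_Mapping.keys f. mon_degree t = i}"

definition form_part :: "nat \<Rightarrow> ('x::finite, 'k::field) mpoly \<Rightarrow> ('x, 'k) mpoly" where
  "form_part i f =
     (\<Sum>t\<in>{t \<in> Poly_Mapping.keys f. mon_degree t = i}.
        Poly_Mapping.single t (Poly_Mapping.lookup f t))"

definition homogeneous_ideal :: "('x::finite, 'k::field) mpoly set \<Rightarrow> bool" where
  "homogeneous_ideal I \<longleftrightarrow> ideal I poly_ring \<and> (\<forall>f\<in>I. \<forall>i. form_part i f \<in> I)"

text \<open>
  The algebra \<open>A = R/I\<close> is represented by the ideal \<open>I\<close>; its elements are cosets of \<open>I\<close>.
\<close>

abbreviation quot_alg :: "('x::finite, 'k::field) mpoly set \<Rightarrow> ('x, 'k) mpoly set ring" where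
  "quot_alg I \<equiv> poly_ring Quot I"

definition residue_class ::
    "('x::finite, 'k::field) mpoly set \<Rightarrow> ('x, 'k) mpoly \<Rightarrow> ('x, 'k) mpoly set" where
  "residue_class I f = I +>\<^bsub>poly_ring\<^esub> f"

text \<open>
  The library measures dimensions over a subfield of the ring itself, so \<open>K\<close> is
  identified with its image in \<open>A\<close> (see \<open>scalars_subfield\<close> below).
\<close>

definition scalars :: "('x::finite, 'k::field) mpoly set \<Rightarrow> ('x, 'k) mpoly set set" where
  "scalars I = range (\<lambda>c. residue_class I (Poly_Mapping.single 0 c))"

definition graded_piece ::
    "('x::finite, 'k::field) mpoly set \<Rightarrow> nat \<Rightarrow> ('x, 'k) mpoly set set" where
  "graded_piece I i = residue_class I ` forms i"

definition standard_graded_artinian :: "('x::finite, 'k::field) mpoly set \<Rightarrow> bool" where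
  "standard_graded_artinian I \<longleftrightarrow>
     homogeneous_ideal I \<and>
     ring.finite_dimension (quot_alg I) (scalars I) (carrier (quot_alg I))"

definition hilbert_function :: "('x::finite, 'k::field) mpoly set \<Rightarrow> nat \<Rightarrow> nat" where
  "hilbert_function I i = ring.dim (quot_alg I) (scalars I) (graded_piece I i)"

definition has_socle_degree :: "('x::finite, 'k::field) mpoly set \<Rightarrow> nat \<Rightarrow> bool" where
  "has_socle_degree I d \<longleftrightarrow>
     graded_piece I d \<noteq> {\<zero>\<^bsub>quot_alg I\<^esub>} \<and> (\<forall>i>d. graded_piece I i = {\<zero>\<^bsub>quot_alg I\<^esub>})"

definition irrelevant_ideal ::
    "('x::finite, 'k::field) mpoly set \<Rightarrow> ('x, 'k) mpoly set set" where
  "irrelevant_ideal I = genideal (quot_alg I) (graded_piece I 1)"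

definition socle :: "('x::finite, 'k::field) mpoly set \<Rightarrow> ('x, 'k) mpoly set set" where
  "socle I = {a \<in> carrier (quot_alg I).
     \<forall>b\<in>irrelevant_ideal I. b \<otimes>\<^bsub>quot_alg I\<^esub> a = \<zero>\<^bsub>quot_alg I\<^esub>}"

definition gorenstein :: "('x::finite, 'k::field) mpoly set \<Rightarrow> bool" where
  "gorenstein I \<longleftrightarrow>
     ring.dimension (quot_alg I) 1 (scalars I) (socle I) \<and>
     (\<exists>d. has_socle_degree I d \<and> socle I \<subseteq> graded_piece I d)"

definition weak_lefschetz :: "('x::finite, 'k::field) mpoly set \<Rightarrow> bool" where
  "weak_lefschetz I \<longleftrightarrow>
     (\<exists>l\<in>graded_piece I 1. \<forall>i.
        inj_on (\<lambda>a. l \<otimes>\<^bsub>quot_alg I\<^esub> a) (graded_piece I i) \<or>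
        (\<lambda>a. l \<otimes>\<^bsub>quot_alg I\<^esub> a) ` graded_piece I i = graded_piece I (Suc i))"

lemma quot_alg_ring:
  assumes "ideal I (poly_ring :: ('x::finite, 'k::field) mpoly ring)"
  shows "ring (quot_alg I)"
  using assms by (rule ideal.quotient_is_ring)

lemma scalars_subfield:
  fixes I :: "('x::finite, 'k::field) mpoly set"
  assumes I: "ideal I poly_ring" and proper: "I \<noteq> UNIV"
  shows "subfield (scalars I) (quot_alg I)"
proof -
  let ?K = "ring_of_type_algebra :: 'k ring"
  let ?h = "\<lambda>c. residue_class I (Poly_Mapping.single 0 c)"
  interpret I: ideal I "poly_ring :: ('x, 'k) mpoly ring" by (rule I)
  interpret K: field ?K by (rule field_from_type_algebra)
  have "(\<lambda>c. Poly_Mapping.single 0 c) \<in> ring_hom ?K (poly_ring :: ('x, 'k) mpoly ring)"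
    by (rule ring_hom_memI)
       (auto simp: ring_of_type_algebra_def mult_single single_add)
  from ring_hom_trans[OF this I.rcos_ring_hom]
  have hom: "?h \<in> ring_hom ?K (quot_alg I)"
    by (simp add: residue_class_def[abs_def] comp_def)
  interpret h: ring_hom_ring ?K "quot_alg I" ?h
    by (rule ring_hom_ringI2[OF K.ring_axioms I.quotient_is_ring hom])
  have "\<one>\<^bsub>quot_alg I\<^esub> \<noteq> \<zero>\<^bsub>quot_alg I\<^esub>"
    using I.quotient_eq_iff_same_a_r_cos proper I.one_imp_carrier
      I.a_rcos_self[of "\<one>\<^bsub>poly_ring\<^esub>"]
    by (auto simp: FactRing_def ring_of_type_algebra_def)
  then have "subfield (?h ` carrier ?K) (quot_alg I)"
    using h.img_is_subfield(2)[OF K.carrier_is_subfield] by blast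
  then show ?thesis
    by (simp add: scalars_def ring_of_type_algebra_def)
qed

end

theory Submission
  imports Defs "HOL-Computational_Algebra.Polynomial"
begin

text \<open>
  Let \<open>R\<close> be the polynomial ring with graded pieces \<open>R\<^sub>i\<close>, let \<open>A = R/I\<close>, and write \<open>d = 2m + 1\<close> for the
  socle degree. As \<open>A\<close> is Gorenstein, a nonzero class of degree below \<open>d\<close> survives multiplication by
  some linear form. Hence it is enough to find a linear form \<open>l\<close> for which multiplication
  \<open>A\<^sub>m \<rightarrow> A\<^sub>m\<^sub>+\<^sub>1\<close> is bijective (\<open>ex_maximal_rank\<close>), and both spaces have dimension \<open>2m + 2\<close>. Suppose
  that no such \<open>l\<close> exists.

  A dimension of at most \<open>2(m + 1)\<close> in degree \<open>m + 1\<close> is so small that, by Green's restriction argument,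
  \<open>A/lA\<close> has dimension at most one in degree \<open>m + 1\<close> for generic \<open>l\<close> (\<open>hyperplane_section_le_one\<close>).
  So the kernel of \<open>l\<close> on \<open>A\<^sub>m\<close> is spanned by a single class \<open>z\<close>. The rank is maximal at generic \<open>l\<close>, so
  the kernel persists when \<open>l\<close> moves to \<open>l + tb\<close>. To first order this says \<open>bz \<in> lA\<^sub>m\<close> for all
  linear forms \<open>b\<close>, whence \<open>bz\<^sup>2 = 0\<close> and \<open>z\<^sup>2 = 0\<close>. This is the idea of Gordan and Noether in
  their study of forms with vanishing Hessian. There are two cases.

  Suppose first that \<open>zA\<^sub>1\<close> is a line for all generic \<open>l\<close> (\<open>rank_one_kernels_impossible\<close>). The linear forms
  that kill \<open>z\<close> form a hyperplane, and varying \<open>l\<close> gives classes \<open>z\<^sub>0, \<dots>, z\<^sub>m\<^sub>+\<^sub>1\<close> with pairwise different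
  hyperplanes. All products \<open>z\<^sub>iz\<^sub>j\<close> vanish. Products of linear forms chosen from these hyperplanes
  give \<open>g\<^sub>0, \<dots>, g\<^sub>m\<close> in \<open>A\<^sub>m\<close> such that, for \<open>i, j \<le> m\<close>, the product \<open>g\<^sub>iz\<^sub>j\<close> vanishes exactly if
  \<open>i \<noteq> j\<close>. All these \<open>2m + 3\<close> classes are independent, which is too many for \<open>A\<^sub>m\<close>.

  Otherwise \<open>zA\<^sub>1\<close> has dimension at least two for some generic \<open>l\<close> (locale \<open>large_kernel_ideal\<close>). Then
  \<open>l\<close> is injective below degree \<open>m\<close>, and counting dimensions shows that the annihilator of \<open>z\<close> is \<open>lA\<close> in
  the degrees from \<open>2\<close> to \<open>m\<close>. Deforming the powers of \<open>l\<close> to first order yields, step by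
  step, \<open>z = l\<^sup>m\<^sup>-\<^sup>1v\<close> for a linear form \<open>v\<close> with \<open>vA\<^sub>1 \<subseteq> lA\<^sub>1\<close>. Write \<open>bv = lT\<close> with \<open>T\<close> depending on \<open>b\<close>. The
  second-order term of the deformation of \<open>l\<^sup>mv = 0\<close> gives \<open>zbT = 0\<close>. Polarising, and using that \<open>T\<close>
  is self-adjoint for the product with \<open>v\<close>, one gets \<open>zT = 0\<close>. But the linear
  forms killing \<open>z\<close> are spanned by \<open>l\<close> and \<open>v\<close>, so \<open>bz = l\<^sup>m\<^sup>-\<^sup>1bv = l\<^sup>mT\<close> is a multiple of \<open>l\<^sup>m\<^sup>+\<^sup>1\<close> for
  every \<open>b\<close>, and \<open>zA\<^sub>1\<close> is a line after all.

  Everything happens in \<open>R\<close>: a statement about \<open>A\<close> is one about membership in \<open>I\<close>, and dimensions in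
  \<open>A\<close> are differences of dimensions of subspaces of some \<open>R\<^sub>i\<close>.
\<close>

section \<open>Finitely spanned subspaces\<close>

text \<open>
  The space of all polynomials has infinite dimension, where \<open>dim\<close> is not monotone. The lemmas of this
  section recover the usual facts for the subspaces that lie in the span of a finite set.
\<close>

locale fin_vector_space = vector_space
begin

definition fin_spanned :: "'b set \<Rightarrow> bool" where
  "fin_spanned S \<longleftrightarrow> (\<exists>B. finite B \<and> S \<subseteq> span B)"

lemma fin_spanned_subset: "fin_spanned T \<Longrightarrow> S \<subseteq> T \<Longrightarrow> fin_spanned S"
  unfolding fin_spanned_def by blast

lemma fin_spanned_span: "fin_spanned T \<Longrightarrow> fin_spanned (span T)"
  unfolding fin_spanned_def by (metis span_mono span_span)

lemma fin_spanned_basis: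
  assumes "fin_spanned S"
  obtains B where "finite B" "B \<subseteq> S" "independent B" "S \<subseteq> span B" "card B = dim S"
proof -
  obtain B where B: "B \<subseteq> S" "independent B" "S \<subseteq> span B" "card B = dim S"
    by (rule basis_exists)
  obtain D where "finite D" "S \<subseteq> span D" using assms unfolding fin_spanned_def by auto
  then have "finite B" using independent_span_bound[of D B] B by blast
  with B show ?thesis using that by blast
qed

lemma independent_card_le:
  assumes "fin_spanned T" "independent B" "B \<subseteq> span T"
  shows "finite B" "card B \<le> dim T"
proof -
  obtain D where D: "finite D" "T \<subseteq> span D" "card D = dim T"
    using fin_spanned_basis[OF assms(1)] by metis
  then have "B \<subseteq> span D" using assms(3) by (metis span_mono span_span subset_trans)
  then show "finite B" "card B \<le> dim T"
    using independent_span_bound[OF D(1) assms(2)] D(3) by auto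
qed

lemma dim_mono_fin:
  assumes "fin_spanned T" "S \<subseteq> span T"
  shows "dim S \<le> dim T"
proof -
  obtain B where "B \<subseteq> S" "independent B" "card B = dim S" by (rule basis_exists)
  then show ?thesis using independent_card_le[OF assms(1), of B] assms(2) by auto
qed

lemma subspace_eq_of_dim:
  assumes "fin_spanned T" "S \<subseteq> span T" "dim T \<le> dim S"
  shows "T \<subseteq> span S"
proof (rule ccontr)
  assume "\<not> ?thesis"
  then obtain x where x: "x \<in> T" "x \<notin> span S" by auto
  obtain B where B: "B \<subseteq> S" "independent B" "S \<subseteq> span B" "card B = dim S" by (rule basis_exists)
  have "x \<notin> span B" using x(2) span_mono[OF B(1)] by (rule contra_subsetD[rotated])
  then have i: "independent (insert x B)" "x \<notin> B" using B(2) independent_insertI span_base by auto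
  have sub: "insert x B \<subseteq> span T" using x(1) B(1) assms(2) span_base by auto
  note c = independent_card_le[OF assms(1) i(1) sub]
  then show False using assms(3) B(4) i(2) by auto
qed

lemma dim_insert_fin:
  assumes "fin_spanned S" "x \<notin> span S"
  shows "dim (insert x S) = Suc (dim S)"
proof -
  obtain B where B: "finite B" "B \<subseteq> S" "independent B" "S \<subseteq> span B" "card B = dim S"
    by (rule fin_spanned_basis[OF assms(1)])
  have "x \<notin> span B" using assms(2) span_mono[OF B(2)] by (rule contra_subsetD[rotated])
  then have i: "independent (insert x B)" "x \<notin> B" using B(3) independent_insertI span_base by auto
  have "insert x S \<subseteq> span (insert x B)"
    using B(4) span_base span_mono[of B "insert x B"] by blast
  then have "dim (insert x S) = card (insert x B)"
    using basis_card_eq_dim[of "insert x B" "insert x S"] i(1) B(2)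
    by (metis insert_mono)
  then show ?thesis using i(2) B by auto
qed

lemma dim_insert_le:
  assumes "fin_spanned S"
  shows "dim (insert x S) \<le> Suc (dim S)"
proof (cases "x \<in> span S")
  case True
  then show ?thesis using span_redundant span_eq_dim by (metis le_SucI order_refl)
next
  case False
  then show ?thesis using dim_insert_fin[OF assms] by auto
qed

text \<open>
  The rank-nullity theorem for the map \<open>S \<rightarrow> W / J\<close> induced by \<open>f\<close>, stated without forming
  the quotient.
\<close>

lemma dim_preimage_sum:
  assumes f: "Vector_Spaces.linear scale scale f" and S: "subspace S" "fin_spanned S"
    and J: "subspace J" "fin_spanned J"
  shows "dim {x \<in> S. f x \<in> J} + dim (J \<union> f ` S) = dim S + dim J"
proof -
  interpret f: Vector_Spaces.linear scale scale f by (rule f)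
  let ?P = "{x \<in> S. f x \<in> J}"
  have fP: "fin_spanned ?P" using S(2) by (rule fin_spanned_subset) auto
  obtain B where B: "finite B" "B \<subseteq> ?P" "independent B" "?P \<subseteq> span B" "card B = dim ?P"
    by (rule fin_spanned_basis[OF fP])
  obtain C where C: "finite C" "C \<subseteq> J" "independent C" "J \<subseteq> span C" "card C = dim J"
    by (rule fin_spanned_basis[OF J(2)])
  obtain D where D: "B \<subseteq> D" "D \<subseteq> S" "independent D" "S \<subseteq> span D"
    using maximal_independent_subset_extend[of B S] B by blast
  have fD: "finite D" using independent_card_le[OF S(2) D(3)] D(2) span_base by blast
  have cD: "card D = dim S" using basis_card_eq_dim[OF D(2) D(4) D(3)] .
  define E where "E = D - B"
  have fE: "finite E" and cE: "card E + card B = card D"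
    using fD D(1) card_mono[OF fD D(1)] finite_subset[OF D(1) fD]
    by (auto simp: E_def card_Diff_subset)
  \<comment> \<open>a combination of the images of \<open>E\<close> that lies in \<open>J\<close> is trivial\<close>
  have triv: "c e = 0" if "(\<Sum>e\<in>E. c e *s f e) \<in> J" "e \<in> E" for c e
  proof -
    let ?s = "\<Sum>e\<in>E. c e *s e"
    have "?s \<in> S" using D(2) by (intro subspace_sum[OF S(1)] subspace_scale[OF S(1)]) (auto simp: E_def)
    moreover have "f ?s \<in> J" using that(1) by (simp add: f.sum f.scale)
    ultimately have "?s \<in> span B" using B(4) by auto
    then obtain g where g: "?s = (\<Sum>b\<in>B. g b *s b)"
      using span_finite[OF B(1)] by auto
    let ?u = "\<lambda>x. if x \<in> B then - g x else c x"
    have "(\<Sum>x\<in>D. ?u x *s x) = (\<Sum>x\<in>B. ?u x *s x) + (\<Sum>x\<in>E. ?u x *s x)"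
      using sum.subset_diff[OF D(1) fD, of "\<lambda>x. ?u x *s x"] unfolding E_def by (simp only: add.commute)
    also have "(\<Sum>x\<in>B. ?u x *s x) = - (\<Sum>b\<in>B. g b *s b)" by (simp add: sum_negf)
    also have "(\<Sum>x\<in>E. ?u x *s x) = ?s" by (rule sum.cong) (auto simp: E_def)
    finally have "(\<Sum>x\<in>D. ?u x *s x) = 0" using g by simp
    then have "?u e = 0"
      using independent_explicit_finite_subsets[THEN iffD1, OF D(3), rule_format, of D ?u e]
        fD that(2) by (auto simp: E_def)
    then show ?thesis using that(2) by (auto simp: E_def)
  qed
  have inj: "inj_on f E"
  proof (rule inj_onI)
    fix x y assume xy: "x \<in> E" "y \<in> E" "f x = f y"
    show "x = y"
    proof (rule ccontr)
      assume n: "x \<noteq> y"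
      let ?c = "\<lambda>e. if e = x then 1 else if e = y then -1 else 0"
      have "(\<Sum>e\<in>E. ?c e *s f e) = (\<Sum>e\<in>{x,y}. ?c e *s f e)"
        using xy fE by (intro sum.mono_neutral_right) auto
      also have "\<dots> = 0" using n xy by simp
      finally have "(\<Sum>e\<in>E. ?c e *s f e) \<in> J" using J(1) subspace_0 by simp
      from triv[OF this xy(1)] show False by simp
    qed
  qed
  have disj: "C \<inter> f ` E = {}"
  proof (rule ccontr)
    assume "\<not> ?thesis"
    then obtain e where e: "e \<in> E" "f e \<in> J" using C(2) by auto
    have "(\<Sum>x\<in>E. (if x = e then 1 else 0) *s f x) = (\<Sum>x\<in>{e}. (if x = e then 1 else 0) *s f x)"
      using e fE by (intro sum.mono_neutral_right) auto
    then have "(\<Sum>x\<in>E. (if x = e then 1 else 0) *s f x) \<in> J" using e by simp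
    from triv[OF this e(1)] show False by simp
  qed
  have "independent (C \<union> f ` E)"
  proof (rule independent_if_scalars_zero)
    show "finite (C \<union> f ` E)" using C(1) fE by auto
    fix g x assume 0: "(\<Sum>x\<in>C \<union> f ` E. g x *s x) = 0" and x: "x \<in> C \<union> f ` E"
    have "(\<Sum>x\<in>C \<union> f ` E. g x *s x) = (\<Sum>x\<in>C. g x *s x) + (\<Sum>e\<in>E. g (f e) *s f e)"
      using disj C(1) fE by (simp add: sum.union_disjoint sum.reindex[OF inj] o_def)
    with 0 have eq: "(\<Sum>e\<in>E. g (f e) *s f e) = - (\<Sum>x\<in>C. g x *s x)"
      by (simp add: eq_neg_iff_add_eq_0 add.commute)
    have "(\<Sum>x\<in>C. g x *s x) \<in> J"
      using C(2) by (intro subspace_sum[OF J(1)] subspace_scale[OF J(1)]) auto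
    then have "(\<Sum>e\<in>E. g (f e) *s f e) \<in> J" using eq J(1) subspace_neg by auto
    from triv[OF this] have z: "g (f e) = 0" if "e \<in> E" for e using that by blast
    then have "(\<Sum>x\<in>C. g x *s x) = 0" using eq by simp
    then have "g x = 0" if "x \<in> C" for x
      using independent_explicit_finite_subsets[THEN iffD1, OF C(3), rule_format, of C g x]
        C(1) that by simp
    then show "g x = 0" using z x by auto
  qed
  moreover have "C \<union> f ` E \<subseteq> J \<union> f ` S" using C(2) D(2) by (auto simp: E_def)
  moreover have "J \<union> f ` S \<subseteq> span (C \<union> f ` E)"
  proof -
    have "J \<subseteq> span (C \<union> f ` E)" using C(4) span_mono[of C "C \<union> f ` E"] by blast
    moreover have "f x \<in> span (C \<union> f ` E)" if "x \<in> S" for x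
    proof -
      have "f ` D \<subseteq> span (C \<union> f ` E)"
      proof
        fix y assume "y \<in> f ` D"
        then obtain d where d: "d \<in> D" "y = f d" by auto
        show "y \<in> span (C \<union> f ` E)"
        proof (cases "d \<in> B")
          case True
          then have "y \<in> J" using d B(2) by auto
          then show ?thesis using \<open>J \<subseteq> span (C \<union> f ` E)\<close> by auto
        next
          case False
          then show ?thesis using d by (auto simp: E_def intro: span_base)
        qed
      qed
      then have "span (f ` D) \<subseteq> span (C \<union> f ` E)" using span_minimal subspace_span by blast
      moreover have "f x \<in> span (f ` D)" using D(4) that f.span_image by blast
      ultimately show ?thesis by auto
    qed
    ultimately show ?thesis by auto
  qed
  ultimately have "dim (J \<union> f ` S) = card (C \<union> f ` E)"
    using basis_card_eq_dim by metis
  also have "\<dots> = card C + card E"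
    using disj C(1) fE by (simp add: card_Un_disjoint card_image[OF inj])
  finally show ?thesis using B(5) C(5) cD cE by simp
qed

end

section \<open>Forms\<close>

abbreviation cst :: "'k::field \<Rightarrow> ('x::finite, 'k) mpoly" where
  "cst c \<equiv> Poly_Mapping.single 0 c"

lemma cst_mult: "cst (a * b) = cst a * (cst b :: ('x::finite, 'k::field) mpoly)"
  by (simp add: mult_single)

lemma cst_add: "cst (a + b) = cst a + (cst b :: ('x::finite, 'k::field) mpoly)"
  by (simp add: single_add)

lemma cst_neg: "cst (- a) = - (cst a :: ('x::finite, 'k::field) mpoly)"
  by (simp add: single_uminus)

lemma cst_sum: "cst (sum f A) = (\<Sum>x\<in>A. (cst (f x) :: ('x::finite, 'k::field) mpoly))"
  by (induction A rule: infinite_finite_induct) (auto simp: cst_add)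

lemma lookup_cst_mult:
  "Poly_Mapping.lookup (cst c * (f :: ('x::finite, 'k::field) mpoly)) k = c * Poly_Mapping.lookup f k"
  by (simp add: mult_map_scale_conv_mult[symmetric] Poly_Mapping.map.rep_eq when_def)

interpretation mp: fin_vector_space "\<lambda>c (f :: ('x::finite, 'k::field) mpoly). cst c * f"
  by unfold_locales (simp_all add: algebra_simps cst_add cst_mult)

lemma mon_degree_add: "mon_degree (s + t) = mon_degree s + mon_degree t"
  by (simp add: mon_degree_def lookup_add sum.distrib)

lemma mon_degree_zero [simp]: "mon_degree 0 = 0"
  by (simp add: mon_degree_def)

lemma mon_degree_single [simp]: "mon_degree (Poly_Mapping.single x n) = n"
proof -
  have "(\<Sum>y\<in>UNIV. Poly_Mapping.lookup (Poly_Mapping.single x n) y) = (\<Sum>y\<in>{x}. Poly_Mapping.lookup (Poly_Mapping.single x n) y)"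
    by (rule sum.mono_neutral_right) (auto simp: lookup_single when_def)
  then show ?thesis by (simp add: mon_degree_def)
qed

lemma finite_mon_degree: "finite {t :: 'x::finite \<Rightarrow>\<^sub>0 nat. mon_degree t = i}"
proof -
  let ?S = "{t :: 'x::finite \<Rightarrow>\<^sub>0 nat. mon_degree t = i}"
  have "Poly_Mapping.lookup ` ?S \<subseteq> Pi\<^sub>E UNIV (\<lambda>_. {..i})"
  proof
    fix f assume "f \<in> Poly_Mapping.lookup ` ?S"
    then obtain t where t: "f = Poly_Mapping.lookup t" "mon_degree t = i" by auto
    have "f x \<le> i" for x
      using member_le_sum[of x UNIV f] t by (auto simp: mon_degree_def)
    then show "f \<in> Pi\<^sub>E UNIV (\<lambda>_. {..i})" by auto
  qed
  then have "finite (Poly_Mapping.lookup ` ?S)"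
    by (rule finite_subset) (intro finite_PiE, auto)
  moreover have "inj_on Poly_Mapping.lookup ?S"
    by (rule inj_onI) (rule poly_mapping_eqI, simp)
  ultimately show ?thesis by (rule finite_imageD)
qed

lemma forms_zero [simp]: "0 \<in> forms i"
  by (simp add: forms_def)

lemma forms_add: "f \<in> forms i \<Longrightarrow> g \<in> forms i \<Longrightarrow> f + g \<in> forms i"
  unfolding forms_def using Poly_Mapping.keys_add[of f g] by blast

lemma forms_mult: "f \<in> forms i \<Longrightarrow> g \<in> forms j \<Longrightarrow> f * g \<in> forms (i + j)"
  unfolding forms_def using keys_mult[of f g] by (fastforce simp: mon_degree_add)

lemma forms_single [simp]: "mon_degree t = i \<Longrightarrow> Poly_Mapping.single t c \<in> forms i"
  by (simp add: forms_def)

lemma forms_cst: "cst c \<in> forms 0"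
  by simp

lemma forms_scale: "f \<in> forms i \<Longrightarrow> cst c * f \<in> forms i"
  using forms_mult[OF forms_cst] by fastforce

lemma forms_subspace: "mp.subspace (forms i)"
  by (rule mp.subspaceI) (auto simp: forms_add forms_scale)

lemma forms_neg: "f \<in> forms i \<Longrightarrow> - f \<in> forms i"
  by (rule mp.subspace_neg[OF forms_subspace])

lemma forms_diff: "f \<in> forms i \<Longrightarrow> g \<in> forms i \<Longrightarrow> f - g \<in> forms i"
  by (rule mp.subspace_diff[OF forms_subspace])

lemma forms_power: "f \<in> forms i \<Longrightarrow> f ^ n \<in> forms (n * i)"
  by (induction n) (auto intro: forms_mult forms_cst[of 1, simplified])

lemma forms_power_one: "f \<in> forms 1 \<Longrightarrow> f ^ n \<in> forms n"
  using forms_power[of f 1 n] by simp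

lemma forms_one_mult: "f \<in> forms 1 \<Longrightarrow> g \<in> forms i \<Longrightarrow> f * g \<in> forms (Suc i)"
  using forms_mult[of f 1 g i] by simp

lemma mpoly_as_sum:
  "(f :: ('x::finite, 'k::field) mpoly) =
     (\<Sum>t\<in>Poly_Mapping.keys f. Poly_Mapping.single t (Poly_Mapping.lookup f t))"
proof (rule poly_mapping_eqI)
  fix k
  have "(\<Sum>t\<in>Poly_Mapping.keys f. Poly_Mapping.lookup (Poly_Mapping.single t (Poly_Mapping.lookup f t)) k)
      = (\<Sum>t\<in>Poly_Mapping.keys f. if k = t then Poly_Mapping.lookup f t else 0)"
    by (rule sum.cong) (auto simp: lookup_single when_def)
  also have "\<dots> = Poly_Mapping.lookup f k"
    by (simp add: in_keys_iff)
  finally show "Poly_Mapping.lookup f k = Poly_Mapping.lookup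
     (\<Sum>t\<in>Poly_Mapping.keys f. Poly_Mapping.single t (Poly_Mapping.lookup f t)) k"
    by (simp add: lookup_sum)
qed

lemma fin_spanned_forms: "mp.fin_spanned (forms i :: ('x::finite, 'k::field) mpoly set)"
  unfolding mp.fin_spanned_def
proof (intro exI conjI subsetI)
  let ?B = "(\<lambda>t. Poly_Mapping.single t 1) ` {t. mon_degree t = i}"
  show "finite ?B" by (intro finite_imageI finite_mon_degree)
  fix f :: "('x, 'k) mpoly" assume f: "f \<in> forms i"
  have "(\<Sum>t\<in>Poly_Mapping.keys f. Poly_Mapping.single t (Poly_Mapping.lookup f t)) \<in> mp.span ?B"
  proof (rule mp.span_sum)
    fix t assume "t \<in> Poly_Mapping.keys f"
    then have "cst (Poly_Mapping.lookup f t) * Poly_Mapping.single t 1 \<in> mp.span ?B"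
      using f by (intro mp.span_scale mp.span_base) (auto simp: forms_def)
    then show "Poly_Mapping.single t (Poly_Mapping.lookup f t) \<in> mp.span ?B"
      by (simp add: mult_single)
  qed
  then show "f \<in> mp.span ?B" using mpoly_as_sum[of f] by simp
qed

text \<open>
  The ring is standard graded: it suffices to split one variable off each monomial.
\<close>

lemma forms_Suc_span:
  assumes "f \<in> forms (Suc i)"
  shows "f \<in> mp.span {a * g | a g. a \<in> forms 1 \<and> g \<in> forms i}"
proof -
  let ?G = "{a * g | a g. a \<in> forms 1 \<and> g \<in> forms i}"
  have "(\<Sum>t\<in>Poly_Mapping.keys f. Poly_Mapping.single t (Poly_Mapping.lookup f t)) \<in> mp.span ?G"
  proof (rule mp.span_sum)
    fix t assume "t \<in> Poly_Mapping.keys f"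
    then have t: "mon_degree t = Suc i" using assms by (auto simp: forms_def)
    then obtain x where x: "Poly_Mapping.lookup t x \<noteq> 0"
      unfolding mon_degree_def by (metis (no_types, lifting) nat.distinct(1) sum.neutral)
    define s where "s = t - Poly_Mapping.single x 1"
    have ts: "t = Poly_Mapping.single x 1 + s"
      using x by (intro poly_mapping_eqI) (auto simp: s_def lookup_add lookup_minus lookup_single when_def)
    then have "mon_degree s = i" using t by (simp add: mon_degree_add)
    then have "Poly_Mapping.single (Poly_Mapping.single x 1) 1 * Poly_Mapping.single s (Poly_Mapping.lookup f t) \<in> ?G"
      by (intro CollectI exI conjI refl) auto
    then have "Poly_Mapping.single (Poly_Mapping.single x 1 + s) (Poly_Mapping.lookup f t) \<in> ?G"
      by (simp only: mult_single mult_1)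
    then show "Poly_Mapping.single t (Poly_Mapping.lookup f t) \<in> mp.span ?G"
      unfolding ts[symmetric] by (rule mp.span_base)
  qed
  then show ?thesis using mpoly_as_sum[of f] by simp
qed

section \<open>Polynomial families of forms\<close>

abbreviation ev :: "('x::finite, 'k::field) mpoly poly \<Rightarrow> 'k \<Rightarrow> ('x, 'k) mpoly" where
  "ev p t \<equiv> poly p (cst t)"

lemma poly_map_cst: "ev (map_poly cst F) t = cst (poly F t)"
  by (induction F) (auto simp: map_poly_pCons cst_add cst_mult)

lemma lookup_ev:
  "Poly_Mapping.lookup (ev p t) k = poly (map_poly (\<lambda>v. Poly_Mapping.lookup v k) p) t"
  by (induction p) (auto simp: map_poly_pCons lookup_add lookup_cst_mult)

text \<open>
  Gaussian elimination over the polynomials in \<open>t\<close>. Pick a monomial \<open>k\<close> whose coefficient in the new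
  vector \<open>w\<^sub>b\<close> is nonzero at \<open>t = 0\<close>. Replacing \<open>w\<^sub>x\<close> by the combination of \<open>w\<^sub>x\<close> and \<open>w\<^sub>b\<close> without \<open>k\<close> keeps the
  family independent at \<open>0\<close>, and it preserves independence in the other direction wherever the
  coefficient of \<open>k\<close> in \<open>w\<^sub>b\<close> does not vanish.
\<close>

lemma independent_family_cofinite:
  fixes w :: "'b \<Rightarrow> ('x::finite, 'k::field) mpoly poly"
  assumes "finite C"
    and "\<And>c. (\<Sum>b\<in>C. cst (c b) * ev (w b) 0) = 0 \<Longrightarrow> \<forall>b\<in>C. c b = 0"
  shows "finite {t. \<exists>c. (\<Sum>b\<in>C. cst (c b) * ev (w b) t) = 0 \<and> (\<exists>b\<in>C. c b \<noteq> 0)}"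
  using assms
proof (induction C arbitrary: w)
  case empty
  then show ?case by simp
next
  case (insert b C)
  have "ev (w b) 0 \<noteq> 0"
  proof
    assume 0: "ev (w b) 0 = 0"
    have "(\<Sum>x\<in>insert b C. cst (if x = b then 1 else 0) * ev (w x) 0) = 0"
      using 0 insert(1,2) by (auto intro!: sum.neutral)
    from insert(4)[OF this] show False by simp
  qed
  then obtain k where k: "Poly_Mapping.lookup (ev (w b) 0) k \<noteq> 0"
    using poly_mapping_eqI[of "ev (w b) 0" 0] by auto
  define F where "F x = map_poly (\<lambda>v. Poly_Mapping.lookup v k) (w x)" for x
  have F: "Poly_Mapping.lookup (ev (w x) t) k = poly (F x) t" for x t
    by (simp add: F_def lookup_ev)
  define w' where "w' x = map_poly cst (F b) * w x - map_poly cst (F x) * w b" for x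
  have w': "ev (w' x) t = cst (poly (F b) t) * ev (w x) t - cst (poly (F x) t) * ev (w b) t" for x t
    by (simp add: w'_def poly_map_cst)
  have sum_w': "(\<Sum>x\<in>C. cst (c x) * ev (w' x) t)
      = cst (poly (F b) t) * (\<Sum>x\<in>C. cst (c x) * ev (w x) t)
        - cst (\<Sum>x\<in>C. c x * poly (F x) t) * ev (w b) t" for c t
    unfolding w' right_diff_distrib sum_subtractf sum_distrib_left sum_distrib_right cst_mult cst_sum
    by (simp only: mult.assoc mult.left_commute)
  have "\<forall>x\<in>C. c x = 0" if "(\<Sum>x\<in>C. cst (c x) * ev (w' x) 0) = 0" for c
  proof -
    let ?c = "\<lambda>x. if x = b then - (\<Sum>x\<in>C. c x * poly (F x) 0) else poly (F b) 0 * c x"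
    have "(\<Sum>x\<in>C. cst (?c x) * ev (w x) 0) = (\<Sum>x\<in>C. cst (poly (F b) 0 * c x) * ev (w x) 0)"
      using insert(2) by (intro sum.cong) auto
    also have "\<dots> = cst (poly (F b) 0) * (\<Sum>x\<in>C. cst (c x) * ev (w x) 0)"
      by (simp only: sum_distrib_left cst_mult mult.assoc)
    finally have "(\<Sum>x\<in>insert b C. cst (?c x) * ev (w x) 0) = 0"
      using that insert(1,2) sum_w'[of c 0] by (simp add: cst_neg)
    from insert(4)[OF this] have "poly (F b) 0 * c x = 0" if "x \<in> C" for x
      using that insert(2) by (metis insertCI)
    then show ?thesis using k F[of b 0] by auto
  qed
  from insert(3)[of w', OF this]
  have fin: "finite {t. \<exists>c. (\<Sum>x\<in>C. cst (c x) * ev (w' x) t) = 0 \<and> (\<exists>x\<in>C. c x \<noteq> 0)}" .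
  have "F b \<noteq> 0" using k F[of b 0] by auto
  then have fin2: "finite {t. poly (F b) t = 0}" by (rule poly_roots_finite)
  show ?case
  proof (rule finite_subset[OF subsetI finite_UnI[OF fin fin2]])
    fix t assume "t \<in> {t. \<exists>c. (\<Sum>x\<in>insert b C. cst (c x) * ev (w x) t) = 0 \<and> (\<exists>x\<in>insert b C. c x \<noteq> 0)}"
    then obtain c where c: "(\<Sum>x\<in>insert b C. cst (c x) * ev (w x) t) = 0" "\<exists>x\<in>insert b C. c x \<noteq> 0" by auto
    let ?S = "\<Sum>x\<in>C. cst (c x) * ev (w x) t"
    have S: "?S = - (cst (c b) * ev (w b) t)"
      using c(1) insert(1,2) by (simp add: eq_neg_iff_add_eq_0 add.commute)
    have "Poly_Mapping.lookup ?S k = (\<Sum>x\<in>C. c x * poly (F x) t)"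
      by (simp add: lookup_sum lookup_cst_mult F)
    moreover have "Poly_Mapping.lookup (- (cst (c b) * ev (w b) t)) k = - (c b * poly (F b) t)"
      by (simp add: lookup_cst_mult F)
    ultimately have "(\<Sum>x\<in>C. c x * poly (F x) t) = - (c b * poly (F b) t)" using S by simp
    then have z: "(\<Sum>x\<in>C. cst (c x) * ev (w' x) t) = 0"
      unfolding sum_w' S by (simp only: cst_neg cst_mult) (simp add: mult.left_commute mult.assoc)
    show "t \<in> {t. \<exists>c. (\<Sum>x\<in>C. cst (c x) * ev (w' x) t) = 0 \<and> (\<exists>x\<in>C. c x \<noteq> 0)} \<union> {t. poly (F b) t = 0}"
    proof (cases "poly (F b) t = 0")
      case False
      have "\<exists>x\<in>C. c x \<noteq> 0"
      proof (rule ccontr)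
        assume "\<not> ?thesis"
        then have "c b \<noteq> 0" "(\<Sum>x\<in>C. c x * poly (F x) t) = 0" using c(2) by auto
        then show False using \<open>(\<Sum>x\<in>C. c x * poly (F x) t) = - (c b * poly (F b) t)\<close> False by simp
      qed
      then show ?thesis using z by blast
    qed simp
  qed
qed

text \<open>
  Lower semicontinuity of the rank: a basis at \<open>t = 0\<close> lifts to members of the family, which stay
  independent for almost all \<open>t\<close>.
\<close>

lemma dim_family_lower_semicontinuous:
  fixes W :: "('x::finite, 'k::field) mpoly poly set"
  assumes T: "mp.fin_spanned T" "\<And>t. (\<lambda>p. ev p t) ` W \<subseteq> mp.span T"
    and n: "n \<le> mp.dim ((\<lambda>p. ev p 0) ` W)"
  shows "finite {t. mp.dim ((\<lambda>p. ev p t) ` W) < n}"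
proof -
  have f: "mp.fin_spanned ((\<lambda>p. ev p t) ` W)" for t
    using mp.fin_spanned_subset[OF mp.fin_spanned_span[OF T(1)] T(2)] .
  obtain B where B: "finite B" "B \<subseteq> (\<lambda>p. ev p 0) ` W" "mp.independent B" "card B = mp.dim ((\<lambda>p. ev p 0) ` W)"
    by (rule mp.fin_spanned_basis[OF f])
  obtain B' where B': "B' \<subseteq> B" "card B' = n"
    using n B(4) by (metis obtain_subset_with_card_n)
  have iB': "mp.independent B'" "finite B'" using B B' mp.independent_mono finite_subset by auto
  have "B' \<subseteq> (\<lambda>p. ev p 0) ` W" using B B' by auto
  then obtain C where C: "C \<subseteq> W" "inj_on (\<lambda>p. ev p 0) C" "(\<lambda>p. ev p 0) ` C = B'"
    by (metis subset_image_inj)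
  have fC: "finite C" using C(2,3) iB'(2) finite_imageD by blast
  have cC: "card C = n" using C(2,3) B'(2) card_image by force
  let ?bad = "{t. \<exists>c. (\<Sum>p\<in>C. cst (c p) * ev p t) = 0 \<and> (\<exists>p\<in>C. c p \<noteq> 0)}"
  have "\<forall>p\<in>C. c p = 0" if "(\<Sum>p\<in>C. cst (c p) * ev p 0) = 0" for c
  proof -
    let ?g = "\<lambda>v. c (the_inv_into C (\<lambda>p. ev p 0) v)"
    have g: "?g (ev p 0) = c p" if "p \<in> C" for p
      by (simp only: the_inv_into_f_f[OF C(2) that])
    have "(\<Sum>v\<in>B'. cst (?g v) * v) = (\<Sum>p\<in>C. cst (?g (ev p 0)) * ev p 0)"
      unfolding C(3)[symmetric] by (subst sum.reindex[OF C(2)]) (simp only: o_def)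
    also have "\<dots> = (\<Sum>p\<in>C. cst (c p) * ev p 0)"
      by (rule sum.cong) (simp_all only: g)
    finally have "(\<Sum>v\<in>B'. cst (?g v) * v) = (\<Sum>p\<in>C. cst (c p) * ev p 0)" .
    with that have "\<forall>v\<in>B'. ?g v = 0"
      using mp.independent_explicit_finite_subsets[THEN iffD1, OF iB'(1), rule_format, of B' ?g] iB'(2) by auto
    then show ?thesis unfolding C(3)[symmetric] using g by force
  qed
  then have fin: "finite ?bad" using independent_family_cofinite[OF fC, of "\<lambda>p. p"] by blast
  show ?thesis
  proof (rule finite_subset[OF subsetI fin], rule ccontr)
    fix t assume t: "t \<in> {t. mp.dim ((\<lambda>p. ev p t) ` W) < n}" "t \<notin> ?bad"
    have ind: "c p = 0" if "(\<Sum>p\<in>C. cst (c p) * ev p t) = 0" "p \<in> C" for c p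
      using t(2) that by auto
    have inj: "inj_on (\<lambda>p. ev p t) C"
    proof (rule inj_onI, rule ccontr)
      fix p q assume pq: "p \<in> C" "q \<in> C" "ev p t = ev q t" "p \<noteq> q"
      let ?c = "\<lambda>r. if r = p then (1 :: 'k) else if r = q then -1 else 0"
      have "(\<Sum>r\<in>C. cst (?c r) * ev r t) = (\<Sum>r\<in>{p,q}. cst (?c r) * ev r t)"
        using pq fC by (intro sum.mono_neutral_right) auto
      also have "\<dots> = 0" using pq(3,4) by (simp add: cst_neg)
      finally have "?c p = 0" using ind[of ?c p] pq(1) by blast
      then show False by simp
    qed
    have "mp.independent ((\<lambda>p. ev p t) ` C)"
    proof (rule mp.independent_if_scalars_zero)
      show "finite ((\<lambda>p. ev p t) ` C)" using fC by simp
      fix g x assume "(\<Sum>x\<in>(\<lambda>p. ev p t) ` C. cst (g x) * x) = 0" and x: "x \<in> (\<lambda>p. ev p t) ` C"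
      then have "(\<Sum>p\<in>C. cst (g (ev p t)) * ev p t) = 0" by (simp add: sum.reindex[OF inj])
      then show "g x = 0" using ind[of "\<lambda>p. g (ev p t)"] x by auto
    qed
    moreover have "(\<lambda>p. ev p t) ` C \<subseteq> mp.span ((\<lambda>p. ev p t) ` W)"
      using C(1) by (auto intro: mp.span_base)
    ultimately have "card ((\<lambda>p. ev p t) ` C) \<le> mp.dim ((\<lambda>p. ev p t) ` W)"
      by (rule mp.independent_card_le(2)[OF f])
    then show False using t(1) cC card_image[OF inj] by simp
  qed
qed

section \<open>Adjoining the multiples of a form\<close>

lemma dim_subset_forms:
  fixes S :: "('x::finite, 'k::field) mpoly set"
  shows "S \<subseteq> mp.span (forms i) \<Longrightarrow> mp.dim S \<le> mp.dim (forms i :: ('x, 'k) mpoly set)"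
  by (rule mp.dim_mono_fin[OF fin_spanned_forms])

lemma span_forms [simp]: "mp.span (forms i) = forms i"
  by (rule mp.span_eq_iff[THEN iffD2, OF forms_subspace])

lemma span_mult_image:
  assumes "f \<in> mp.span S" and "\<And>g. g \<in> S \<Longrightarrow> y * g \<in> mp.span T"
  shows "y * f \<in> mp.span T"
  using assms(1)
proof (induction rule: mp.span_induct_alt)
  case base
  then show ?case by (simp add: mp.span_zero)
next
  case (step c x z)
  have "y * (cst c * x + z) = cst c * (y * x) + y * z" by (simp add: algebra_simps)
  then show ?case using step assms(2) by (simp add: mp.span_add mp.span_scale)
qed

lemma linear_mult: "Vector_Spaces.linear (\<lambda>c f. cst c * f) (\<lambda>c f. cst c * f) (\<lambda>f. (y :: ('x::finite, 'k::field) mpoly) * f)"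
  by unfold_locales (simp_all add: algebra_simps)

definition add_multiples :: "('x::finite, 'k::field) mpoly set \<Rightarrow> nat \<Rightarrow> ('x, 'k) mpoly \<Rightarrow> ('x, 'k) mpoly set" where
  "add_multiples J i y = J \<union> (\<lambda>f. y * f) ` forms i"

lemma add_multiples_subset_forms:
  "J \<subseteq> forms (e + i) \<Longrightarrow> y \<in> forms e \<Longrightarrow> add_multiples J i y \<subseteq> forms (e + i)"
  by (auto simp: add_multiples_def intro: forms_mult)

text \<open>
  In the quotient by \<open>J\<close>: the kernel and the image of multiplication by \<open>y\<close> on \<open>R\<^sub>i\<close>.
\<close>

lemma dim_colon:
  fixes J :: "('x::finite, 'k::field) mpoly set"
  assumes "mp.subspace J" "J \<subseteq> forms (e + i)"
  shows "mp.dim {f \<in> forms i. y * f \<in> J} + mp.dim (add_multiples J i y)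
    = mp.dim (forms i :: ('x, 'k) mpoly set) + mp.dim J"
  unfolding add_multiples_def
  by (rule mp.dim_preimage_sum[OF linear_mult forms_subspace fin_spanned_forms assms(1)
        mp.fin_spanned_subset[OF fin_spanned_forms assms(2)]])

lemma colon_subspace:
  assumes "mp.subspace J"
  shows "mp.subspace {f \<in> forms i. y * f \<in> J}"
proof (rule mp.subspaceI)
  show "0 \<in> {f \<in> forms i. y * f \<in> J}" using mp.subspace_0[OF assms] by simp
  show "f + g \<in> {f \<in> forms i. y * f \<in> J}" if "f \<in> {f \<in> forms i. y * f \<in> J}" "g \<in> {f \<in> forms i. y * f \<in> J}" for f g
    using that mp.subspace_add[OF assms] by (auto simp: forms_add distrib_left)
  show "cst c * f \<in> {f \<in> forms i. y * f \<in> J}" if "f \<in> {f \<in> forms i. y * f \<in> J}" for c f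
    using that mp.subspace_scale[OF assms, of "y * f" c] by (auto simp: forms_scale mult.left_commute)
qed

section \<open>Generic linear forms\<close>

text \<open>
  A substitute for nonempty Zariski open sets of linear forms: the condition holds somewhere, and on
  every line through a point where it holds it fails only finitely often. Two such sets meet on the
  line that joins a point of one with a point of the other, so they are closed under intersection.
\<close>

definition line_open :: "(('x::finite, 'k::field_char_0) mpoly \<Rightarrow> bool) \<Rightarrow> bool" where
  "line_open P \<longleftrightarrow> (\<exists>x\<in>forms 1. P x) \<and>
     (\<forall>x\<in>forms 1. \<forall>y\<in>forms 1. P x \<longrightarrow> finite {t. \<not> P (x + cst t * y)})"

lemma forms_line: "x \<in> forms i \<Longrightarrow> y \<in> forms i \<Longrightarrow> x + cst t * y \<in> forms i"
  by (simp add: forms_add forms_scale)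

lemma line_open_conj:
  fixes P Q :: "('x::finite, 'k::field_char_0) mpoly \<Rightarrow> bool"
  assumes "line_open P" "line_open Q"
  shows "line_open (\<lambda>x. P x \<and> Q x)"
proof -
  obtain x y where x: "x \<in> forms 1" "P x" and y: "y \<in> forms 1" "Q y"
    using assms unfolding line_open_def by metis
  have d: "y - x \<in> forms 1" "x - y \<in> forms 1" using x y by (auto intro: forms_diff)
  have "finite {t. \<not> P (x + cst t * (y - x))}"
    using assms(1) x d by (simp add: line_open_def)
  moreover have "finite ((\<lambda>s. 1 - s) ` {s. \<not> Q (y + cst s * (x - y))})"
    using assms(2) y d by (intro finite_imageI) (simp add: line_open_def)
  ultimately have "finite ({t. \<not> P (x + cst t * (y - x))} \<union> (\<lambda>s. 1 - s) ` {s. \<not> Q (y + cst s * (x - y))})"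
    by simp
  then obtain t where t: "t \<notin> {t. \<not> P (x + cst t * (y - x))} \<union> (\<lambda>s. 1 - s) ` {s. \<not> Q (y + cst s * (x - y))}"
    using ex_new_if_finite[OF infinite_UNIV_char_0] by metis
  have eq: "y + cst (1 - t) * (x - y) = x + cst t * (y - x)"
    by (simp add: single_diff algebra_simps)
  have "P (x + cst t * (y - x))" using t by auto
  moreover have "Q (y + cst (1 - t) * (x - y))"
  proof (rule ccontr)
    assume "\<not> ?thesis"
    then have "1 - (1 - t) \<in> (\<lambda>s. 1 - s) ` {s. \<not> Q (y + cst s * (x - y))}" by blast
    then show False using t by simp
  qed
  moreover have "x + cst t * (y - x) \<in> forms 1" using x d by (simp add: forms_line)
  ultimately have "\<exists>x\<in>forms 1. P x \<and> Q x" unfolding eq by blast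
  moreover have "finite {t. \<not> (P (x + cst t * y) \<and> Q (x + cst t * y))}"
    if "x \<in> forms 1" "y \<in> forms 1" "P x \<and> Q x" for x y
  proof -
    have "finite ({t. \<not> P (x + cst t * y)} \<union> {t. \<not> Q (x + cst t * y)})"
      using assms that by (simp add: line_open_def)
    then show ?thesis by (rule rev_finite_subset) auto
  qed
  ultimately show ?thesis unfolding line_open_def by blast
qed

definition generic :: "(('x::finite, 'k::field_char_0) mpoly \<Rightarrow> bool) \<Rightarrow> bool" where
  "generic P \<longleftrightarrow> (\<exists>Q. line_open Q \<and> (\<forall>x\<in>forms 1. Q x \<longrightarrow> P x))"

lemma line_open_imp_generic: "line_open P \<Longrightarrow> generic P"
  unfolding generic_def by blast

lemma generic_ex: "generic P \<Longrightarrow> \<exists>x\<in>forms 1. P x"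
  unfolding generic_def line_open_def by blast

lemma generic_mono: "generic P \<Longrightarrow> (\<And>x. x \<in> forms 1 \<Longrightarrow> P x \<Longrightarrow> Q x) \<Longrightarrow> generic Q"
  unfolding generic_def by blast

lemma generic_conj:
  assumes "generic P" "generic Q"
  shows "generic (\<lambda>x. P x \<and> Q x)"
proof -
  obtain P' Q' where "line_open P'" "\<forall>x\<in>forms 1. P' x \<longrightarrow> P x" "line_open Q'" "\<forall>x\<in>forms 1. Q' x \<longrightarrow> Q x"
    using assms unfolding generic_def by blast
  then show ?thesis
    unfolding generic_def by (intro exI[of _ "\<lambda>x. P' x \<and> Q' x"]) (simp add: line_open_conj)
qed

lemma generic_True:
  assumes "\<And>x. x \<in> forms 1 \<Longrightarrow> P x" shows "generic P"
proof -
  have "line_open (\<lambda>x::('x::finite, 'k::field_char_0) mpoly. True)"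
    unfolding line_open_def by (intro conjI bexI[of _ 0] forms_zero TrueI ballI impI) simp
  then show ?thesis using assms unfolding generic_def by blast
qed

lemma generic_ball:
  assumes "finite F" "\<And>i. i \<in> F \<Longrightarrow> generic (P i)"
  shows "generic (\<lambda>x. \<forall>i\<in>F. P i x)"
  using assms
proof (induction F rule: finite_induct)
  case empty
  show ?case by (rule generic_True) simp
next
  case (insert i F)
  have "generic (\<lambda>x. P i x \<and> (\<forall>i\<in>F. P i x))" by (rule generic_conj) (use insert in auto)
  then show ?case by (rule generic_mono) simp
qed

lemma generic_dim_ge:
  fixes J :: "('x::finite, 'k::field_char_0) mpoly set"
  assumes "J \<subseteq> forms (e + i)" "x \<in> forms 1" "n \<le> mp.dim (add_multiples J i (x ^ e))"
  shows "generic (\<lambda>x. n \<le> mp.dim (add_multiples J i (x ^ e)))"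
proof (rule line_open_imp_generic, unfold line_open_def)
  show "(\<exists>x\<in>forms 1. n \<le> mp.dim (add_multiples J i (x ^ e))) \<and> (\<forall>x\<in>forms 1. \<forall>y\<in>forms 1.
     n \<le> mp.dim (add_multiples J i (x ^ e)) \<longrightarrow>
     finite {t. \<not> n \<le> mp.dim (add_multiples J i ((x + cst t * y) ^ e))})"
proof (intro conjI ballI impI)
  show "\<exists>x\<in>forms 1. n \<le> mp.dim (add_multiples J i (x ^ e))" using assms by blast
  fix x y :: "('x, 'k) mpoly"
  assume xy: "x \<in> forms 1" "y \<in> forms 1" and n: "n \<le> mp.dim (add_multiples J i (x ^ e))"
  define W where "W = (\<lambda>j. [:j:]) ` J \<union> (\<lambda>f. [:x, y:] ^ e * [:f:]) ` forms i"
  have W: "(\<lambda>p. ev p t) ` W = add_multiples J i ((x + cst t * y) ^ e)" for t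
    by (simp add: W_def add_multiples_def image_Un image_image mult.commute)
  have "finite {t. mp.dim ((\<lambda>p. ev p t) ` W) < n}"
  proof (rule dim_family_lower_semicontinuous[OF fin_spanned_forms])
    show "(\<lambda>p. ev p t) ` W \<subseteq> mp.span (forms (e + i))" for t
      unfolding W using add_multiples_subset_forms[OF assms(1) forms_power_one[OF forms_line[OF xy]]] by simp
    show "n \<le> mp.dim ((\<lambda>p. ev p 0) ` W)" using n W[of 0] by simp
  qed
  then show "finite {t. \<not> n \<le> mp.dim (add_multiples J i ((x + cst t * y) ^ e))}"
    by (simp add: W not_le)
qed
qed

lemma generic_max_dim:
  fixes J :: "('x::finite, 'k::field_char_0) mpoly set"
  assumes "J \<subseteq> forms (e + i)"
  shows "generic (\<lambda>x. \<forall>y\<in>forms 1. mp.dim (add_multiples J i (y ^ e)) \<le> mp.dim (add_multiples J i (x ^ e)))"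
proof -
  let ?D = "\<lambda>x. mp.dim (add_multiples J i (x ^ e))"
  have bound: "?D x \<le> mp.dim (forms (e + i) :: ('x, 'k) mpoly set)" if "x \<in> forms 1" for x :: "('x, 'k) mpoly"
    using add_multiples_subset_forms[OF assms forms_power_one[OF that]] by (intro dim_subset_forms) simp
  have fin: "finite (?D ` forms 1)"
    by (rule finite_subset[of _ "{..mp.dim (forms (e + i) :: ('x, 'k) mpoly set)}"]) (auto simp: bound)
  have ne: "?D ` forms 1 \<noteq> {}" using forms_zero by blast
  from Max_in[OF fin ne] obtain x where x: "x \<in> forms 1" "?D x = Max (?D ` forms 1)" by auto
  have "generic (\<lambda>z. ?D x \<le> ?D z)" using generic_dim_ge[OF assms x(1)] by simp
  then show ?thesis
  proof (rule generic_mono)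
    fix z :: "('x, 'k) mpoly" assume z: "z \<in> forms 1" "?D x \<le> ?D z"
    then show "\<forall>y\<in>forms 1. ?D y \<le> ?D z"
      using x fin by (metis (no_types, lifting) Max_ge dual_order.trans image_eqI)
  qed
qed

section \<open>Restriction to a generic hyperplane\<close>

text \<open>
  This section is the case of small dimension of Green's hyperplane restriction theorem. For a
  subspace \<open>J\<close> of \<open>R\<^sub>d\<^sub>+\<^sub>1\<close> and a linear form \<open>y\<close>, the codimension of \<open>J\<close> is the sum of those of
  \<open>J + yR\<^sub>d\<close> in \<open>R\<^sub>d\<^sub>+\<^sub>1\<close> and of \<open>J : y\<close> in \<open>R\<^sub>d\<close>. If adjoining the multiples of \<open>y\<close> leaves a large codimension, then
  that of \<open>J : y\<close> is small, and induction on the degree applies to it.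
\<close>

lemma mult_colon_in_span:
  assumes "f \<in> mp.span (add_multiples {g \<in> forms (Suc d). y * g \<in> J} d x)" "y \<in> forms 1"
  shows "y * f \<in> mp.span (add_multiples J (Suc d) x)"
  using assms(1)
proof (rule span_mult_image)
  fix g assume "g \<in> add_multiples {g \<in> forms (Suc d). y * g \<in> J} d x"
  then show "y * g \<in> mp.span (add_multiples J (Suc d) x)"
    using forms_one_mult[OF assms(2)] by (auto simp: add_multiples_def mult.left_commute intro!: mp.span_base)
qed

lemma forms_subset_span_if_linear_multiples:
  fixes F T :: "('x::finite, 'k::field) mpoly set"
  assumes "forms 1 \<subseteq> mp.span F" "\<And>y f. y \<in> F \<Longrightarrow> f \<in> forms d \<Longrightarrow> y * f \<in> mp.span T"
  shows "forms (Suc d) \<subseteq> mp.span T"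
proof
  fix g :: "('x, 'k) mpoly" assume "g \<in> forms (Suc d)"
  then have "g \<in> mp.span {a * f | a f. a \<in> forms 1 \<and> f \<in> forms d}" by (rule forms_Suc_span)
  moreover have "{a * f | a f. a \<in> forms 1 \<and> f \<in> forms d} \<subseteq> mp.span T"
  proof clarify
    fix a f :: "('x, 'k) mpoly" assume a: "a \<in> forms 1" and f: "f \<in> forms d"
    have "f * a \<in> mp.span T"
      using a assms(1) assms(2)[OF _ f] by (intro span_mult_image[of a F]) (auto simp: mult.commute)
    then show "a * f \<in> mp.span T" by (simp add: mult.commute)
  qed
  ultimately show "g \<in> mp.span T" using mp.span_minimal[OF _ mp.subspace_span] by blast
qed

text \<open>
  If all the \<open>J : y\<close> have small codimension, then the induction hypothesis provides, for each \<open>y\<close>, an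
  \<open>x\<close> with \<open>yR\<^sub>d \<subseteq> J + xR\<^sub>d\<close>. As this holds for generic \<open>x\<close>, one \<open>x\<close> serves all \<open>y\<close> in a basis of
  the linear forms, and then \<open>J + xR\<^sub>d\<close> is everything.
\<close>

lemma hyperplane_section_zero_step:
  fixes J :: "('x::finite, 'k::field_char_0) mpoly set"
  assumes J: "mp.subspace J" "J \<subseteq> forms (Suc d)"
    and small: "\<And>y. y \<in> forms 1 \<Longrightarrow>
      mp.dim (forms d :: ('x, 'k) mpoly set) \<le> mp.dim {f \<in> forms d. y * f \<in> J} + d"
    and IH: "\<And>d' J. d = Suc d' \<Longrightarrow> mp.subspace J \<Longrightarrow> J \<subseteq> (forms (Suc d') :: ('x, 'k) mpoly set) \<Longrightarrow>
      mp.dim (forms (Suc d') :: ('x, 'k) mpoly set) \<le> mp.dim J + Suc d' \<Longrightarrow>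
      \<exists>x\<in>forms 1. forms (Suc d') \<subseteq> mp.span (add_multiples J d' x)"
  shows "\<exists>x\<in>forms 1. forms (Suc d) \<subseteq> mp.span (add_multiples J d x)"
proof -
  let ?C = "\<lambda>y. {f \<in> forms d. y * f \<in> J}"
  obtain F :: "('x, 'k) mpoly set" where F: "finite F" "F \<subseteq> forms 1" "forms 1 \<subseteq> mp.span F"
    by (rule mp.fin_spanned_basis[OF fin_spanned_forms])
  have "generic (\<lambda>x. \<forall>f\<in>forms d. y * f \<in> mp.span (add_multiples J d x))" if y: "y \<in> forms 1" for y
  proof (cases d)
    case 0
    have "?C y \<subseteq> mp.span (forms d)" by auto
    then have "forms d \<subseteq> mp.span (?C y)"
      using small[OF y] 0 by (intro mp.subspace_eq_of_dim[OF fin_spanned_forms]) auto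
    then have "forms d \<subseteq> ?C y" using mp.span_eq_iff[THEN iffD2, OF colon_subspace[OF J(1)]] by blast
    then have "y * f \<in> mp.span (add_multiples J d x)" if "f \<in> forms d" for f x
      using that by (auto simp: add_multiples_def intro: mp.span_base)
    then show ?thesis by (intro generic_True) auto
  next
    case (Suc d')
    have C: "mp.subspace (?C y)" "?C y \<subseteq> forms (Suc d')" using colon_subspace[OF J(1)] Suc by auto
    obtain x where x: "x \<in> forms 1" "forms (Suc d') \<subseteq> mp.span (add_multiples (?C y) d' x)"
      using IH[OF Suc C] small[OF y] Suc by auto
    let ?n = "mp.dim (forms (Suc d') :: ('x, 'k) mpoly set)"
    have sub: "add_multiples (?C y) d' z \<subseteq> forms (Suc d')" if "z \<in> forms 1" for z
      using add_multiples_subset_forms[of "?C y" 1 d' z] C that by simp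
    have "?n \<le> mp.dim (add_multiples (?C y) d' (x ^ 1))"
      using mp.dim_mono_fin[OF mp.fin_spanned_subset[OF fin_spanned_forms sub[OF x(1)]] x(2)] by simp
    then have "generic (\<lambda>z. ?n \<le> mp.dim (add_multiples (?C y) d' (z ^ 1)))"
      using C(2) x(1) by (intro generic_dim_ge) auto
    note g = this
    have h: "y * f \<in> mp.span (add_multiples J d z)"
      if z: "z \<in> forms 1" "?n \<le> mp.dim (add_multiples (?C y) d' (z ^ 1))" and f: "f \<in> forms d" for z f
    proof -
      have "forms (Suc d') \<subseteq> mp.span (add_multiples (?C y) d' z)"
        using z sub[OF z(1)] by (intro mp.subspace_eq_of_dim[OF fin_spanned_forms]) auto
      then have "f \<in> mp.span (add_multiples {g \<in> forms (Suc d'). y * g \<in> J} d' z)" using f Suc by auto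
      then show ?thesis using mult_colon_in_span[OF _ y] Suc by blast
    qed
    from g show ?thesis by (rule generic_mono) (use h in blast)
  qed
  then have "generic (\<lambda>x. \<forall>y\<in>F. \<forall>f\<in>forms d. y * f \<in> mp.span (add_multiples J d x))"
    by (rule generic_ball[OF F(1)]) (use F(2) in blast)
  then obtain x where x: "x \<in> forms 1" "\<forall>y\<in>F. \<forall>f\<in>forms d. y * f \<in> mp.span (add_multiples J d x)"
    using generic_ex by blast
  then have "forms (Suc d) \<subseteq> mp.span (add_multiples J d x)"
    using F(3) by (intro forms_subset_span_if_linear_multiples) auto
  then show ?thesis using x(1) by blast
qed

text \<open>
  A nonzero codimension after adjoining \<open>yR\<^sub>d\<close> leaves at most \<open>d\<close> for \<open>J : y\<close>, so \<open>hyperplane_section_zero_step\<close>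
  applies.
\<close>

lemma hyperplane_section_zero:
  fixes J :: "('x::finite, 'k::field_char_0) mpoly set"
  assumes "mp.subspace J" "J \<subseteq> forms (Suc d)"
    and "mp.dim (forms (Suc d) :: ('x, 'k) mpoly set) \<le> mp.dim J + Suc d"
  shows "\<exists>x\<in>forms 1. forms (Suc d) \<subseteq> mp.span (add_multiples J d x)"
  using assms
proof (induction d arbitrary: J rule: less_induct)
  case (less d)
  show ?case
  proof (rule ccontr)
    assume neg: "\<not> ?thesis"
    have "mp.dim (forms d :: ('x, 'k) mpoly set) \<le> mp.dim {f \<in> forms d. y * f \<in> J} + d"
      if y: "y \<in> forms 1" for y
    proof -
      have "mp.dim (add_multiples J d y) < mp.dim (forms (Suc d) :: ('x, 'k) mpoly set)"
      proof (rule ccontr)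
        assume "\<not> ?thesis"
        then have "forms (Suc d) \<subseteq> mp.span (add_multiples J d y)"
          using add_multiples_subset_forms[of J 1 d y] less(3) y
          by (intro mp.subspace_eq_of_dim[OF fin_spanned_forms]) auto
        then show False using neg y by blast
      qed
      then show ?thesis using dim_colon[of J 1 d y] less(2-4) by simp
    qed
    then have "\<exists>x\<in>forms 1. forms (Suc d) \<subseteq> mp.span (add_multiples J d x)"
      by (rule hyperplane_section_zero_step[OF less(2,3)]) (use less(1) in auto)
    then show False using neg by blast
  qed
qed

text \<open>
  Suppose that the codimension \<open>c\<close> of \<open>J + xR\<^sub>d\<close> is at least two for every \<open>x\<close>. If it always exceeds
  \<open>d + 1\<close>, then every \<open>J : y\<close> has codimension at most \<open>d\<close> and \<open>hyperplane_section_zero_step\<close> gives \<open>c = 0\<close>.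
  If \<open>c \<le> d + 1\<close> for some \<open>x\<close>, then \<open>J + xR\<^sub>d + yR\<^sub>d\<close> is everything for some \<open>y\<close>, while \<open>(J : y) + xR\<^sub>d\<^sub>-\<^sub>1\<close> has
  codimension at most one for generic \<open>x\<close>, by induction. So \<open>yR\<^sub>d\<close> adds at most one dimension to
  \<open>J + xR\<^sub>d\<close>, that is \<open>c \<le> 1\<close>.
\<close>

lemma hyperplane_section_le_one:
  fixes J :: "('x::finite, 'k::field_char_0) mpoly set"
  assumes "mp.subspace J" "J \<subseteq> forms (Suc d)"
    and "mp.dim (forms (Suc d) :: ('x, 'k) mpoly set) \<le> mp.dim J + 2 * Suc d"
  shows "\<exists>x\<in>forms 1. mp.dim (forms (Suc d) :: ('x, 'k) mpoly set) \<le> mp.dim (add_multiples J d x) + 1"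
  using assms
proof (induction d arbitrary: J)
  case (0 J)
  let ?N = "mp.dim (forms (Suc 0) :: ('x, 'k) mpoly set)"
  show ?case
  proof (rule ccontr)
    assume neg: "\<not> ?thesis"
    have "mp.dim (forms 0 :: ('x, 'k) mpoly set) \<le> mp.dim {f \<in> forms 0. y * f \<in> J} + 0"
      if "y \<in> forms 1" for y
    proof -
      have "\<not> ?N \<le> mp.dim (add_multiples J 0 y) + 1" using neg that by blast
      then show ?thesis using dim_colon[of J 1 0 y] 0 by simp
    qed
    then have "\<exists>x\<in>forms 1. forms (Suc 0) \<subseteq> mp.span (add_multiples J 0 x)"
      by (rule hyperplane_section_zero_step[OF 0(1,2)]) auto
    then obtain x where x: "x \<in> forms 1" "forms (Suc 0) \<subseteq> mp.span (add_multiples J 0 x)" by blast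
    have "?N \<le> mp.dim (add_multiples J 0 x)"
      using x 0(2) add_multiples_subset_forms[of J 1 0 x]
      by (intro mp.dim_mono_fin[OF mp.fin_spanned_subset[OF fin_spanned_forms]]) auto
    then show False using neg x(1) by fastforce
  qed
next
  case (Suc d J)
  let ?N = "\<lambda>i. mp.dim (forms i :: ('x, 'k) mpoly set)"
  let ?C = "\<lambda>y. {f \<in> forms (Suc d). y * f \<in> J}"
  note J = Suc.prems(1,2)
  have ext_forms: "add_multiples J (Suc d) x \<subseteq> forms (Suc (Suc d))" if "x \<in> forms 1" for x
    using add_multiples_subset_forms[of J 1 "Suc d" x] J that by simp
  have ext_fin: "mp.fin_spanned (add_multiples J (Suc d) x)" if "x \<in> forms 1" for x
    by (rule mp.fin_spanned_subset[OF fin_spanned_forms ext_forms[OF that]])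
  show ?case
  proof (rule ccontr)
    assume neg: "\<not> ?thesis"
    then have neg': "mp.dim (add_multiples J (Suc d) x) + 2 \<le> ?N (Suc (Suc d))" if "x \<in> forms 1" for x
      using that by fastforce
    have colon: "?N (Suc d) \<le> mp.dim (?C y) + 2 * Suc d" if "y \<in> forms 1" for y
      using neg'[OF that] dim_colon[of J 1 "Suc d" y] Suc.prems by simp
    show False
    proof (cases "\<exists>x\<in>forms 1. ?N (Suc (Suc d)) \<le> mp.dim (add_multiples J (Suc d) x) + Suc (Suc d)")
      case False
      then have "?N (Suc d) \<le> mp.dim (?C y) + Suc d" if "y \<in> forms 1" for y
        using that dim_colon[of J 1 "Suc d" y] Suc.prems by fastforce
      then have "\<exists>x\<in>forms 1. forms (Suc (Suc d)) \<subseteq> mp.span (add_multiples J (Suc d) x)"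
        by (rule hyperplane_section_zero_step[OF J _ hyperplane_section_zero])
      then obtain x where x: "x \<in> forms 1" "forms (Suc (Suc d)) \<subseteq> mp.span (add_multiples J (Suc d) x)" by blast
      then show False using mp.dim_mono_fin[OF ext_fin[OF x(1)] x(2)] neg'[OF x(1)] by simp
    next
      case True
      then obtain x where x: "x \<in> forms 1"
        "?N (Suc (Suc d)) \<le> mp.dim (add_multiples J (Suc d) x) + Suc (Suc d)" by blast
      let ?Jx = "mp.span (add_multiples J (Suc d) x)"
      have Jx: "?Jx \<subseteq> forms (Suc (Suc d))"
        using ext_forms[OF x(1)] mp.span_minimal[OF _ forms_subspace] by blast
      obtain y where y: "y \<in> forms 1" "forms (Suc (Suc d)) \<subseteq> mp.span (add_multiples ?Jx (Suc d) y)"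
        using hyperplane_section_zero[OF mp.subspace_span Jx] x(2) by auto
      \<comment> \<open>\<open>y\<close> was chosen after \<open>x\<close>. With \<open>y\<close> fixed, both conditions are open in the first linear form,
        so they hold together for some \<open>z\<close> in place of \<open>x\<close>.\<close>
      let ?Jy = "add_multiples J (Suc d) y"
      have swap: "mp.span (add_multiples ?Jy (Suc d) z) = mp.span (add_multiples (mp.span (add_multiples J (Suc d) z)) (Suc d) y)" for z
      proof (rule antisym; rule mp.span_minimal[OF _ mp.subspace_span])
        show "add_multiples ?Jy (Suc d) z \<subseteq> mp.span (add_multiples (mp.span (add_multiples J (Suc d) z)) (Suc d) y)"
          by (auto simp: add_multiples_def intro!: mp.span_base)
        have "mp.span (add_multiples J (Suc d) z) \<subseteq> mp.span (add_multiples ?Jy (Suc d) z)"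
          by (rule mp.span_mono) (auto simp: add_multiples_def)
        then show "add_multiples (mp.span (add_multiples J (Suc d) z)) (Suc d) y \<subseteq> mp.span (add_multiples ?Jy (Suc d) z)"
          unfolding add_multiples_def[of "mp.span (add_multiples J (Suc d) z)"]
          by (auto simp: add_multiples_def[of J "Suc d" y] add_multiples_def[of _ "Suc d" z] intro: mp.span_base)
      qed
      have Jy: "?Jy \<subseteq> forms (1 + Suc d)" using ext_forms[OF y(1)] by simp
      have Jyz: "add_multiples ?Jy (Suc d) z \<subseteq> forms (Suc (Suc d))" if "z \<in> forms 1" for z
        using add_multiples_subset_forms[OF Jy that] by simp
      have "?N (Suc (Suc d)) \<le> mp.dim (add_multiples ?Jy (Suc d) x)"
        using y(2) Jyz[OF x(1)] unfolding swap[symmetric]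
        by (intro mp.dim_mono_fin[OF mp.fin_spanned_subset[OF fin_spanned_forms]]) auto
      then have g1: "generic (\<lambda>z. ?N (Suc (Suc d)) \<le> mp.dim (add_multiples ?Jy (Suc d) (z ^ 1)))"
        by (intro generic_dim_ge[OF Jy x(1)]) simp
      have C: "mp.subspace (?C y)" "?C y \<subseteq> forms (Suc d)" using colon_subspace[OF J(1)] by auto
      obtain x' where x': "x' \<in> forms 1" "?N (Suc d) \<le> mp.dim (add_multiples (?C y) d x') + 1"
        using Suc.IH[OF C colon[OF y(1)]] by blast
      then have g2: "generic (\<lambda>z. ?N (Suc d) - 1 \<le> mp.dim (add_multiples (?C y) d (z ^ 1)))"
        using C(2) by (intro generic_dim_ge[of _ _ _ x']) auto
      obtain z where z: "z \<in> forms 1" "?N (Suc (Suc d)) \<le> mp.dim (add_multiples ?Jy (Suc d) z)"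
        "?N (Suc d) \<le> mp.dim (add_multiples (?C y) d z) + 1"
        using generic_ex[OF generic_conj[OF g1 g2]] by fastforce
      let ?S = "add_multiples (?C y) d z"
      have S: "?S \<subseteq> forms (Suc d)" using add_multiples_subset_forms[of "?C y" 1 d z] C(2) z(1) by simp
      have fS: "mp.fin_spanned ?S" by (rule mp.fin_spanned_subset[OF fin_spanned_forms S])
      obtain w where w: "forms (Suc d) \<subseteq> mp.span (insert w ?S)" "w \<in> forms (Suc d)"
      proof (cases "forms (Suc d) \<subseteq> mp.span ?S")
        case True
        then show ?thesis using that[of 0] mp.span_insert_0 by auto
      next
        case False
        then obtain w where w: "w \<in> forms (Suc d)" "w \<notin> mp.span ?S" by blast
        have "?N (Suc d) \<le> mp.dim (insert w ?S)" using mp.dim_insert_fin[OF fS w(2)] z(3) by simp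
        then have "forms (Suc d) \<subseteq> mp.span (insert w ?S)"
          using S w by (intro mp.subspace_eq_of_dim[OF fin_spanned_forms]) auto
        then show ?thesis using that w by blast
      qed
      let ?T = "insert (y * w) (add_multiples J (Suc d) z)"
      have "y * f \<in> mp.span ?T" if "f \<in> forms (Suc d)" for f
      proof (rule span_mult_image)
        show "f \<in> mp.span (insert w ?S)" using w that by auto
        fix g assume "g \<in> insert w ?S"
        then consider "g = w" | "g \<in> mp.span ?S" using mp.span_base by blast
        then show "y * g \<in> mp.span ?T"
        proof cases
          case 2
          then have "y * g \<in> mp.span (add_multiples J (Suc d) z)" by (rule mult_colon_in_span[OF _ y(1)])
          then show ?thesis using mp.span_mono[of _ ?T] by blast
        qed (simp add: mp.span_base)
      qed
      then have "add_multiples ?Jy (Suc d) z \<subseteq> mp.span ?T"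
        by (auto simp: add_multiples_def intro: mp.span_base)
      then have "mp.dim (add_multiples ?Jy (Suc d) z) \<le> mp.dim ?T"
        using ext_forms[OF z(1)] forms_one_mult[OF y(1) w(2)]
        by (intro mp.dim_mono_fin[OF mp.fin_spanned_subset[OF fin_spanned_forms]]) auto
      also have "\<dots> \<le> Suc (mp.dim (add_multiples J (Suc d) z))" by (rule mp.dim_insert_le[OF ext_fin[OF z(1)]])
      finally show False using z(2) neg'[OF z(1)] by simp
    qed
  qed
qed

section \<open>Deformation of a linear form of maximal rank\<close>

lemma cst_power: "(cst t :: ('x::finite, 'k::field) mpoly) ^ j = cst (t ^ j)"
  by (induction j) (simp_all add: cst_mult)

lemma poly_shift_decompose:
  "ev p t = (\<Sum>j<k. cst (t ^ j) * coeff p j) + cst (t ^ k) * ev (poly_shift k p) t"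
proof -
  have "poly p c = (\<Sum>j<k. c ^ j * coeff p j) + c ^ k * poly (poly_shift k p) c" for c
  proof (induction k)
    case (Suc k)
    have "poly_shift k p = pCons (coeff p k) (poly_shift (Suc k) p)"
      by (rule poly_eqI) (simp add: coeff_poly_shift coeff_pCons split: nat.split)
    then show ?case using Suc by (simp add: algebra_simps)
  qed simp
  then show ?thesis by (simp add: cst_power)
qed

text \<open>
  The form in which maximality of the rank is used. Suppose that the image of \<open>x\<^sup>e\<close> in the quotient by
  \<open>J\<close> has the largest possible dimension, and that a polynomial curve \<open>p(t)\<close> lies in the image of
  \<open>(x + ty)\<^sup>e\<close> for all \<open>t\<close> and vanishes to order \<open>k\<close> modulo \<open>J\<close>. Then \<open>p(t)/t\<^sup>k\<close> lies in
  the image for \<open>t \<noteq> 0\<close>. If its value at \<open>0\<close> were outside the image of \<open>x\<^sup>e\<close>, then adjoining it would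
  raise the dimension at \<open>0\<close>, hence by semicontinuity also at some \<open>t \<noteq> 0\<close>, where it adds nothing.
\<close>

lemma coeff_in_image_of_max_dim:
  fixes J :: "('x::finite, 'k::field_char_0) mpoly set"
  assumes J: "mp.subspace J" "J \<subseteq> forms (e + i)" and xy: "x \<in> forms 1" "y \<in> forms 1"
    and max: "\<And>z. z \<in> forms 1 \<Longrightarrow> mp.dim (add_multiples J i (z ^ e)) \<le> mp.dim (add_multiples J i (x ^ e))"
    and p: "\<And>t. ev p t \<in> mp.span (add_multiples J i ((x + cst t * y) ^ e))"
    and low: "\<And>j. j < k \<Longrightarrow> coeff p j \<in> J"
  shows "coeff p k \<in> mp.span (add_multiples J i (x ^ e))"
proof (rule ccontr)
  let ?E = "\<lambda>t. add_multiples J i ((x + cst t * y) ^ e)" and ?q = "poly_shift k p"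
  assume "\<not> ?thesis"
  then have q0: "ev ?q 0 \<notin> mp.span (?E 0)" by (simp add: poly_0_coeff_0 coeff_poly_shift)
  have E: "?E t \<subseteq> forms (e + i)" for t
    by (rule add_multiples_subset_forms[OF J(2) forms_power_one[OF forms_line[OF xy]]])
  have fE: "mp.fin_spanned (?E t)" for t by (rule mp.fin_spanned_subset[OF fin_spanned_forms E])
  let ?T = "forms (e + i) \<union> set (coeffs ?q)"
  have fT: "mp.fin_spanned ?T"
  proof -
    obtain B :: "('x, 'k) mpoly set" where "finite B" "forms (e + i) \<subseteq> mp.span B"
      using fin_spanned_forms[of "e + i"] unfolding mp.fin_spanned_def by blast
    then show ?thesis unfolding mp.fin_spanned_def
      by (intro exI[of _ "B \<union> set (coeffs ?q)"])
        (auto intro: mp.span_base subsetD[OF mp.span_mono[of B]])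
  qed
  have qT: "ev ?q t \<in> mp.span ?T" for t
    unfolding poly_altdef
  proof (rule mp.span_sum)
    fix j assume "j \<in> {..degree ?q}"
    have "coeff ?q j \<in> mp.span ?T"
      using coeff_in_coeffs[of ?q j] \<open>j \<in> {..degree ?q}\<close> by (cases "?q = 0") (auto intro: mp.span_base simp: mp.span_zero)
    then have "cst (t ^ j) * coeff ?q j \<in> mp.span ?T" by (rule mp.span_scale)
    then show "coeff ?q j * cst t ^ j \<in> mp.span ?T"
      by (simp only: mult.commute[of "coeff ?q j"] cst_power)
  qed
  define W where "W = insert ?q ((\<lambda>j. [:j:]) ` J \<union> (\<lambda>f. [:x, y:] ^ e * [:f:]) ` forms i)"
  have W: "(\<lambda>p. ev p t) ` W = insert (ev ?q t) (?E t)" for t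
    by (simp add: W_def add_multiples_def image_Un image_image mult.commute)
  let ?n = "Suc (mp.dim (?E 0))"
  have "finite {t. mp.dim ((\<lambda>p. ev p t) ` W) < ?n}"
  proof (rule dim_family_lower_semicontinuous[OF fT])
    show "(\<lambda>p. ev p t) ` W \<subseteq> mp.span ?T" for t
      unfolding W using qT E by (auto intro: mp.span_base)
    show "?n \<le> mp.dim ((\<lambda>p. ev p 0) ` W)"
      using mp.dim_insert_fin[OF fE q0] W[of 0] by simp
  qed
  then have "finite (insert 0 {t. mp.dim ((\<lambda>p. ev p t) ` W) < ?n})" by simp
  from ex_new_if_finite[OF infinite_UNIV_char_0 this]
  obtain t where "t \<notin> insert 0 {t. mp.dim ((\<lambda>p. ev p t) ` W) < ?n}" by blast
  then have t: "t \<noteq> 0" "?n \<le> mp.dim (insert (ev ?q t) (?E t))"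
    unfolding W by auto
  have "(\<Sum>j<k. cst (t ^ j) * coeff p j) \<in> J"
    using low by (intro mp.subspace_sum[OF J(1)] mp.subspace_scale[OF J(1)]) auto
  then have "(\<Sum>j<k. cst (t ^ j) * coeff p j) \<in> mp.span (?E t)"
    by (intro mp.span_base) (simp add: add_multiples_def)
  from mp.span_diff[OF p[of t] this] have "cst (t ^ k) * ev ?q t \<in> mp.span (?E t)"
    by (simp only: poly_shift_decompose[of p t k] add_diff_cancel_left')
  then have "cst (inverse (t ^ k)) * (cst (t ^ k) * ev ?q t) \<in> mp.span (?E t)" by (rule mp.span_scale)
  then have "ev ?q t \<in> mp.span (?E t)"
    using t(1) unfolding mult.assoc[symmetric] cst_mult[symmetric] by simp
  then have "mp.dim (insert (ev ?q t) (?E t)) = mp.dim (?E t)"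
    using mp.span_eq_dim mp.span_redundant by blast
  also have "\<dots> \<le> mp.dim (?E 0)" using max[OF forms_line[OF xy]] by simp
  finally show False using t(2) by simp
qed

section \<open>Ideals of Gorenstein algebras\<close>

text \<open>
  Degrees are matched syntactically, and \<open>forms 1\<close> should not turn into \<open>forms (Suc 0)\<close>.
\<close>

declare One_nat_def [simp del]

lemma cst_inverse_cancel:
  fixes f :: "('x::finite, 'k::field) mpoly"
  assumes "c \<noteq> 0" shows "cst (inverse c) * (cst c * f) = f"
proof -
  have "cst (inverse c) * (cst c * f) = cst (inverse c * c) * f"
    by (simp only: cst_mult mult.assoc)
  then show ?thesis using assms by simp
qed

lemma span_add_multiplesE:
  assumes "f \<in> mp.span (add_multiples J i y)" "mp.subspace J"
  obtains g where "g \<in> forms i" "f - y * g \<in> J"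
proof -
  have "\<exists>g\<in>forms i. f - y * g \<in> J"
    using assms(1)
  proof (induction rule: mp.span_induct_alt)
    case base
    show ?case by (rule bexI[of _ 0]) (simp_all add: mp.subspace_0[OF assms(2)])
  next
    case (step c x f)
    then obtain g where g: "g \<in> forms i" "f - y * g \<in> J" by blast
    from step(1) consider "x \<in> J" | h where "h \<in> forms i" "x = y * h" by (auto simp: add_multiples_def)
    then show ?case
    proof cases
      case 1
      have "cst c * x + f - y * g = cst c * x + (f - y * g)" by simp
      then show ?thesis using g 1 assms(2) by (metis mp.subspace_add mp.subspace_scale)
    next
      case 2
      have "cst c * x + f - y * (cst c * h + g) = f - y * g" using 2 by (simp add: algebra_simps)
      then show ?thesis using g 2 by (metis forms_add forms_scale)
    qed
  qed
  then show ?thesis using that by blast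
qed

text \<open>
  The properties of \<open>I\<close> on which the argument rests. Assumption \<open>socle_top\<close> is the Gorenstein
  property: below the socle degree \<open>2m + 1\<close> the socle vanishes.
\<close>

locale gorenstein_data =
  fixes I :: "('x::finite, 'k::field_char_0) mpoly set" and m :: nat
  assumes I_zero: "0 \<in> I"
    and I_add: "f \<in> I \<Longrightarrow> g \<in> I \<Longrightarrow> f + g \<in> I"
    and I_mult: "g \<in> I \<Longrightarrow> f * g \<in> I"
    and socle_top: "f \<in> forms i \<Longrightarrow> i \<le> 2 * m \<Longrightarrow> (\<And>a. a \<in> forms 1 \<Longrightarrow> a * f \<in> I) \<Longrightarrow> f \<in> I"
    and m_pos: "1 \<le> m"
    and one_notin: "1 \<notin> I"
    and hilbert: "1 \<le> i \<Longrightarrow> i \<le> m \<Longrightarrow>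
      mp.dim (forms i :: ('x, 'k) mpoly set) = mp.dim (I \<inter> forms i) + (2 * i + 2)"
    and hilbert_middle: "mp.dim (forms (Suc m) :: ('x, 'k) mpoly set) = mp.dim (I \<inter> forms (Suc m)) + (2 * m + 2)"
    and hilbert_top: "mp.dim (forms (2 * m + 1) :: ('x, 'k) mpoly set) = mp.dim (I \<inter> forms (2 * m + 1)) + 1"
begin

lemma I_mult': "g \<in> I \<Longrightarrow> g * f \<in> I"
  using I_mult[of g f] by (simp add: mult.commute)

lemma I_diff: "f \<in> I \<Longrightarrow> g \<in> I \<Longrightarrow> f - g \<in> I"
  using I_add[of f "(-1) * g"] I_mult[of g "-1"] by simp

lemma I_cancel: "cst c * f \<in> I \<Longrightarrow> c \<noteq> 0 \<Longrightarrow> f \<in> I"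
  using I_mult[of "cst c * f" "cst (inverse c)"] by (simp add: cst_inverse_cancel)

lemma I_subspace: "mp.subspace I"
  by (rule mp.subspaceI) (auto intro: I_zero I_add I_mult)

lemma I_part_subspace: "mp.subspace (I \<inter> forms i)"
  by (rule mp.subspace_inter[OF I_subspace forms_subspace])

lemma I_part_fin: "mp.fin_spanned (I \<inter> forms i)"
  by (rule mp.fin_spanned_subset[OF fin_spanned_forms]) auto

lemma span_I_part [simp]: "mp.span (I \<inter> forms i) = I \<inter> forms i"
  by (rule mp.span_eq_iff[THEN iffD2, OF I_part_subspace])

text \<open>
  Nondegeneracy of the pairing of \<open>A\<^sub>i\<close> with \<open>A\<^sub>j\<close>, obtained by multiplying with one linear form at a time;
  for \<open>i + j\<close> equal to the socle degree this is Macaulay duality.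
\<close>

lemma ex_mult_notin:
  assumes "f \<in> forms i" "i + j \<le> 2 * m + 1" "f \<notin> I"
  shows "\<exists>g\<in>forms j. g * f \<notin> I"
  using assms
proof (induction j arbitrary: i f)
  case 0
  then show ?case using forms_cst[of 1] by (intro bexI[of _ 1]) auto
next
  case (Suc j)
  then obtain a where a: "a \<in> forms 1" "a * f \<notin> I" using socle_top[of f i] by fastforce
  have "a * f \<in> forms (Suc i)" by (rule forms_one_mult[OF a(1) Suc.prems(1)])
  then obtain g where g: "g \<in> forms j" "g * (a * f) \<notin> I"
    using Suc.IH[of "a * f" "Suc i"] Suc.prems a(2) by auto
  have "a * g \<in> forms (Suc j)" by (rule forms_one_mult[OF a(1) g(1)])
  moreover have "(a * g) * f \<notin> I" using g(2) by (simp add: ac_simps)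
  ultimately show ?case by blast
qed

lemma ex_linear_notin:
  assumes "f \<in> forms i" "i \<le> 2 * m" "f \<notin> I"
  shows "\<exists>a\<in>forms 1. a * f \<notin> I"
  using ex_mult_notin[OF assms(1), of 1] assms by auto

lemma top_one_dimensional:
  assumes "f \<in> forms (2 * m + 1)" "g \<in> forms (2 * m + 1)" "f \<notin> I"
  shows "\<exists>c. g - cst c * f \<in> I"
proof -
  let ?J = "I \<inter> forms (2 * m + 1)"
  have "mp.dim (insert f ?J) = Suc (mp.dim ?J)"
    using assms(3) by (intro mp.dim_insert_fin[OF I_part_fin]) auto
  then have "forms (2 * m + 1) \<subseteq> mp.span (insert f ?J)"
    using assms(1) hilbert_top by (intro mp.subspace_eq_of_dim[OF fin_spanned_forms]) auto
  then have "g \<in> mp.span (insert f ?J)" using assms(2) by blast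
  then show ?thesis unfolding mp.span_breakdown_eq span_I_part by blast
qed

lemma notin_span_if_separated:
  assumes "\<And>g. g \<in> S \<Longrightarrow> y * g \<in> I" "y * x \<notin> I"
  shows "x \<notin> mp.span S"
proof
  assume "x \<in> mp.span S"
  then have "y * x \<in> mp.span I" by (rule span_mult_image) (use assms(1) in \<open>auto intro: mp.span_base\<close>)
  then show False using assms(2) mp.span_eq_iff[THEN iffD2, OF I_subspace] by simp
qed

section \<open>Kernel elements with one-dimensional linear multiples\<close>

text \<open>
  The dimension of \<open>zA\<^sub>1\<close> is at most one, in the form in which it is applied: modulo the linear forms
  that kill \<open>z\<close>, every linear form is a multiple of any one that does not.
\<close>

definition rank_le_one :: "('x, 'k) mpoly \<Rightarrow> bool" where
  "rank_le_one z \<longleftrightarrow> (\<forall>a\<in>forms 1. \<forall>b\<in>forms 1. a * z \<notin> I \<longrightarrow> (\<exists>c. (b - cst c * a) * z \<in> I))"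

lemma rank_le_oneD:
  "rank_le_one z \<Longrightarrow> a \<in> forms 1 \<Longrightarrow> a * z \<notin> I \<Longrightarrow> b \<in> forms 1 \<Longrightarrow> \<exists>c. (b - cst c * a) * z \<in> I"
  unfolding rank_le_one_def by blast

lemma rank_le_oneI:
  assumes "\<And>a. a \<in> forms 1 \<Longrightarrow> \<exists>c. a * z - cst c * u \<in> I"
  shows "rank_le_one z"
  unfolding rank_le_one_def
proof (intro ballI impI)
  fix a b :: "('x, 'k) mpoly" assume ab: "a \<in> forms 1" "b \<in> forms 1" "a * z \<notin> I"
  obtain c c' where c: "a * z - cst c * u \<in> I" and c': "b * z - cst c' * u \<in> I" using assms ab by blast
  have "c \<noteq> 0" using c ab(3) by auto
  have "(b * z - cst c' * u) - cst (c' / c) * (a * z - cst c * u) \<in> I" by (rule I_diff[OF c' I_mult[OF c]])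
  moreover have "(b * z - cst c' * u) - cst (c' / c) * (a * z - cst c * u)
     = (b - cst (c' / c) * a) * z - (cst c' - cst (c' / c) * cst c) * u" by (simp add: algebra_simps)
  moreover have "cst (c' / c) * cst c = (cst c' :: ('x, 'k) mpoly)"
    using \<open>c \<noteq> 0\<close> by (simp add: cst_mult[symmetric])
  ultimately have "(b - cst (c' / c) * a) * z \<in> I" by simp
  then show "\<exists>c. (b - cst c * a) * z \<in> I" by blast
qed

text \<open>
  If \<open>zA\<^sub>1\<close> is a line, then multiplication by any two linear forms that do not kill \<open>z\<close> agrees up to a
  nonzero scalar on all multiples of \<open>z\<close>. The bound on the number of factors keeps the
  product within the socle degree.
\<close>

lemma prod_notin:
  assumes "rank_le_one z" "z \<in> forms m" "z \<notin> I" "finite T" "card T \<le> m + 1"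
    and "\<And>j. j \<in> T \<Longrightarrow> a j \<in> forms 1 \<and> a j * z \<notin> I"
  shows "prod a T \<in> forms (card T) \<and> prod a T * z \<notin> I"
  using assms(4-6)
proof (induction T rule: finite_induct)
  case empty
  then show ?case using assms(3) forms_cst[of 1] by simp
next
  case (insert j T)
  then have IH: "prod a T \<in> forms (card T)" "prod a T * z \<notin> I" and a: "a j \<in> forms 1" "a j * z \<notin> I" by auto
  have "prod a T * z \<in> forms (card T + m)" by (rule forms_mult[OF IH(1) assms(2)])
  moreover have "card T + m \<le> 2 * m" using insert(1,2,4) by simp
  ultimately obtain b where b: "b \<in> forms 1" "b * (prod a T * z) \<notin> I"
    using ex_linear_notin[OF _ _ IH(2)] by blast
  obtain c where c: "(b - cst c * a j) * z \<in> I" using rank_le_oneD[OF assms(1) a b(1)] by blast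
  have "a j * prod a T * z \<notin> I"
  proof
    assume "a j * prod a T * z \<in> I"
    then have "prod a T * ((b - cst c * a j) * z) + cst c * (a j * prod a T * z) \<in> I" by (rule I_add[OF I_mult[OF c] I_mult])
    moreover have "prod a T * ((b - cst c * a j) * z) + cst c * (a j * prod a T * z) = b * (prod a T * z)"
      by (simp add: algebra_simps)
    ultimately show False using b(2) by simp
  qed
  then show ?case using insert(1,2) forms_one_mult[OF a(1) IH(1)] by simp
qed

lemma line_open_mult_notin:
  assumes "z \<in> forms i" "i \<le> 2 * m" "z \<notin> I"
  shows "line_open (\<lambda>x. x * z \<notin> I)"
  unfolding line_open_def
proof (intro conjI ballI impI)
  show "\<exists>x\<in>forms 1. x * z \<notin> I" by (rule ex_linear_notin[OF assms])
  fix x y :: "('x, 'k) mpoly" assume "x * z \<notin> I"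
  have "s = t" if "(x + cst s * y) * z \<in> I" "(x + cst t * y) * z \<in> I" for s t
  proof (rule ccontr)
    assume "s \<noteq> t"
    have "(x + cst s * y) * z - (x + cst t * y) * z = cst (s - t) * (y * z)"
      by (simp add: algebra_simps single_diff)
    then have "cst (s - t) * (y * z) \<in> I" using I_diff[OF that] by simp
    then have "y * z \<in> I"
      by (rule I_cancel) (use \<open>s \<noteq> t\<close> in simp)
    have "(x + cst s * y) * z - cst s * (y * z) \<in> I" by (rule I_diff[OF that(1) I_mult[OF \<open>y * z \<in> I\<close>]])
    then show False using \<open>x * z \<notin> I\<close> by (simp add: algebra_simps)
  qed
  then have "{t. \<not> (x + cst t * y) * z \<notin> I} \<subseteq> {SOME t. (x + cst t * y) * z \<in> I}"
    by (auto intro: someI2)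
  then show "finite {t. \<not> (x + cst t * y) * z \<notin> I}" by (rule finite_subset) simp
qed

text \<open>
  Choose \<open>l\<^sub>0, l\<^sub>1, \<dots>\<close> one after the other so that \<open>l\<^sub>i\<close> does not kill the earlier \<open>z\<^sub>j\<close>. Then for \<open>i \<noteq> j\<close> some
  linear form \<open>a\<^sub>i\<^sub>j\<close> kills \<open>z\<^sub>j\<close> but not \<open>z\<^sub>i\<close>, because two hyperplanes that are nested are equal. It
  follows that \<open>z\<^sub>iz\<^sub>j = 0\<close>: every linear form is a multiple of \<open>a\<^sub>i\<^sub>j\<close> plus one that kills \<open>z\<^sub>i\<close>, so it
  kills \<open>z\<^sub>iz\<^sub>j\<close>, whose degree \<open>2m\<close> is below the socle degree. With \<open>g\<^sub>i\<close> the product of the \<open>a\<^sub>i\<^sub>j\<close> over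
  \<open>j \<le> m\<close>, \<open>j \<noteq> i\<close>, the \<open>m + 2\<close> classes \<open>z\<^sub>i\<close> and the \<open>m + 1\<close> classes \<open>g\<^sub>i\<close> are independent in \<open>A\<^sub>m\<close>.
\<close>

lemma rank_one_kernels_impossible:
  assumes "generic G"
    and G: "\<And>x. x \<in> forms 1 \<Longrightarrow> G x \<Longrightarrow>
      \<exists>z\<in>forms m. z \<notin> I \<and> x * z \<in> I \<and> z * z \<in> I \<and> rank_le_one z"
  shows False
proof -
  let ?Q = "\<lambda>x z. x \<in> forms 1 \<and> z \<in> forms m \<and> z \<notin> I \<and> x * z \<in> I \<and> z * z \<in> I \<and> rank_le_one z"
  have "\<exists>l z. (\<forall>i<n. ?Q (l i) (z i)) \<and> (\<forall>i<n. \<forall>j<i. l i * z j \<notin> I)" for n :: nat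
  proof (induction n)
    case (Suc n)
    then obtain l z where lz: "\<forall>i<n. ?Q (l i) (z i)" "\<forall>i<n. \<forall>j<i. l i * z j \<notin> I" by blast
    have "generic (\<lambda>x. G x \<and> (\<forall>j\<in>{..<n}. x * z j \<notin> I))"
      by (rule generic_conj[OF assms(1)], rule generic_ball)
        (use lz in \<open>auto intro!: line_open_imp_generic line_open_mult_notin[of _ m]\<close>)
    then obtain x where x: "x \<in> forms 1" "G x" "\<forall>j<n. x * z j \<notin> I" using generic_ex by fastforce
    then obtain y where "?Q x y" using G by blast
    then show ?case using lz x(3)
      by (intro exI[of _ "l(n := x)"] exI[of _ "z(n := y)"]) (auto simp: less_Suc_eq)
  qed auto
  then obtain l z where Q: "\<And>i. i < m + 2 \<Longrightarrow> ?Q (l i) (z i)"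
    and lz: "\<And>i j. i < m + 2 \<Longrightarrow> j < i \<Longrightarrow> l i * z j \<notin> I" by metis
  have "\<exists>a\<in>forms 1. a * z j \<in> I \<and> a * z i \<notin> I" if ij: "i < m + 2" "j < m + 2" "i \<noteq> j" for i j
  proof (cases "i < j")
    case True
    then show ?thesis using lz Q ij by blast
  next
    case False
    then have "j < i" using ij by simp
    show ?thesis
    proof (rule ccontr)
      assume neg: "\<not> ?thesis"
      have "b * z i \<in> I" if b: "b \<in> forms 1" for b
      proof -
        obtain c where c: "(b - cst c * l i) * z j \<in> I"
          using rank_le_oneD[of "z j" "l i" b] Q[OF ij(1)] Q[OF ij(2)] lz[OF ij(1) \<open>j < i\<close>] b by auto
        have "b - cst c * l i \<in> forms 1" using b Q[OF ij(1)] by (auto intro: forms_diff forms_scale)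
        then have "(b - cst c * l i) * z i \<in> I" using neg c by blast
        then have "(b - cst c * l i) * z i + cst c * (l i * z i) \<in> I"
          by (rule I_add[OF _ I_mult]) (use Q[OF ij(1)] in blast)
        then show ?thesis by (simp add: algebra_simps)
      qed
      then have "z i \<in> I" using socle_top[of "z i" m] Q[OF ij(1)] by auto
      then show False using Q[OF ij(1)] by blast
    qed
  qed
  then obtain a where a: "\<And>i j. i < m + 2 \<Longrightarrow> j < m + 2 \<Longrightarrow> i \<noteq> j \<Longrightarrow>
      a i j \<in> forms 1 \<and> a i j * z j \<in> I \<and> a i j * z i \<notin> I" by metis
  have zz: "z i * z j \<in> I" if ij: "i < m + 2" "j < m + 2" for i j
  proof (cases "i = j")
    case False
    note aij = a[OF ij False]
    have "b * (z i * z j) \<in> I" if b: "b \<in> forms 1" for b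
    proof -
      obtain c where c: "(b - cst c * a i j) * z i \<in> I"
        using rank_le_oneD[of "z i" "a i j" b] Q[OF ij(1)] aij b by auto
      have "z j * ((b - cst c * a i j) * z i) + cst c * z i * (a i j * z j) \<in> I"
        by (rule I_add[OF I_mult[OF c] I_mult]) (use aij in blast)
      moreover have "z j * ((b - cst c * a i j) * z i) + cst c * z i * (a i j * z j) = b * (z i * z j)"
        by (simp add: algebra_simps)
      ultimately show ?thesis by simp
    qed
    moreover have "z i * z j \<in> forms (2 * m)" using forms_mult[of "z i" m "z j" m] Q ij by (simp add: mult_2)
    ultimately show ?thesis using socle_top[of "z i * z j" "2 * m"] by blast
  qed (use Q ij in auto)
  let ?J = "I \<inter> forms m"
  have fin: "mp.fin_spanned S" if "S \<subseteq> forms m" for S :: "('x, 'k) mpoly set"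
    by (rule mp.fin_spanned_subset[OF fin_spanned_forms that])
  \<comment> \<open>a product of \<open>n\<close> linear forms kills the earlier \<open>z j\<close> but not \<open>z n\<close>; as \<open>n \<le> m + 1\<close>, its
    degree is small enough for \<open>prod_notin\<close>\<close>
  have dim1: "mp.dim (?J \<union> z ` {..<n}) = mp.dim ?J + n" if "n \<le> m + 2" for n
    using that
  proof (induction n)
    case (Suc n)
    have sub: "?J \<union> z ` {..<n} \<subseteq> forms m" using Q Suc.prems by auto
    have p: "prod (a n) {..<n} * z n \<notin> I"
      using prod_notin[of "z n" "{..<n}" "a n"] Q[of n] a Suc.prems by auto
    have "z n \<notin> mp.span (?J \<union> z ` {..<n})"
    proof (rule notin_span_if_separated[OF _ p])
      fix g assume "g \<in> ?J \<union> z ` {..<n}"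
      then consider "g \<in> I" | j where "j < n" "g = z j" by auto
      then show "prod (a n) {..<n} * g \<in> I"
      proof cases
        case 2
        have "prod (a n) {..<n} * z j = prod (a n) ({..<n} - {j}) * (a n j * z j)"
          using 2 by (simp add: prod.remove[of "{..<n}" j] ac_simps)
        then show ?thesis using a[of n j] 2 Suc.prems I_mult by auto
      qed (rule I_mult)
    qed
    then show ?case using mp.dim_insert_fin[OF fin[OF sub]] Suc by (simp add: lessThan_Suc)
  qed simp
  define g where "g i = prod (a i) ({..<m+1} - {i})" for i
  have g: "g i \<in> forms m" "g i * z i \<notin> I" "\<And>j. j < m + 1 \<Longrightarrow> j \<noteq> i \<Longrightarrow> g i * z j \<in> I" if i: "i < m + 1" for i
  proof -
    have "prod (a i) ({..<m+1} - {i}) \<in> forms (card ({..<m+1} - {i})) \<and> prod (a i) ({..<m+1} - {i}) * z i \<notin> I"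
      using prod_notin[of "z i" "{..<m+1} - {i}" "a i"] Q[of i] a i by auto
    then show "g i \<in> forms m" "g i * z i \<notin> I" using i by (auto simp: g_def)
    fix j assume j: "j < m + 1" "j \<noteq> i"
    have "g i * z j = prod (a i) ({..<m+1} - {i} - {j}) * (a i j * z j)"
      unfolding g_def using j by (subst prod.remove[of _ j]) (auto simp: ac_simps)
    then show "g i * z j \<in> I" using a[of i j] i j I_mult by auto
  qed
  \<comment> \<open>\<open>z n\<close> in turn kills all the \<open>z j\<close> and all the \<open>g j\<close> except \<open>g n\<close>\<close>
  let ?Z = "?J \<union> z ` {..<m+2}"
  have dim2: "mp.dim (?Z \<union> g ` {..<n}) = mp.dim ?J + (m + 2) + n" if "n \<le> m + 1" for n
    using that
  proof (induction n)
    case (Suc n)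
    have sub: "?Z \<union> g ` {..<n} \<subseteq> forms m" using Q g Suc.prems by auto
    have p: "z n * g n \<notin> I" using g(2)[of n] Suc.prems by (simp add: mult.commute)
    have "g n \<notin> mp.span (?Z \<union> g ` {..<n})"
    proof (rule notin_span_if_separated[OF _ p])
      fix h assume "h \<in> ?Z \<union> g ` {..<n}"
      then consider "h \<in> I" | j where "j < m + 2" "h = z j" | j where "j < n" "h = g j" by auto
      then show "z n * h \<in> I"
      proof cases
        case 1
        then show ?thesis by (rule I_mult)
      next
        case 2
        then show ?thesis using zz Suc.prems by auto
      next
        case 3
        then show ?thesis using g(3)[of j n] Suc.prems by (auto simp: mult.commute)
      qed
    qed
    then show ?case using mp.dim_insert_fin[OF fin[OF sub]] Suc by (simp add: lessThan_Suc)
  qed (use dim1[of "m + 2"] in simp)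
  have sub: "?Z \<union> g ` {..<m+1} \<subseteq> mp.span (forms m)" using Q g by auto
  have "mp.dim ?J + (m + 2) + (m + 1) \<le> mp.dim (forms m :: ('x, 'k) mpoly set)"
    using mp.dim_mono_fin[OF fin_spanned_forms sub] dim2[of "m + 1"] by simp
  then show False using hilbert[of m] m_pos by simp
qed

section \<open>Kernel elements with more linear multiples\<close>

text \<open>
  The dimension of \<open>zA\<^sub>i\<close> is at most one. Degree \<open>1\<close> is \<open>rank_le_one\<close>, in a different guise.
\<close>

definition multiples_on_line :: "('x, 'k) mpoly \<Rightarrow> nat \<Rightarrow> bool" where
  "multiples_on_line z i \<longleftrightarrow> (\<exists>u. \<forall>f\<in>forms i. \<exists>c. f * z - cst c * u \<in> I)"

lemma multiple_trans:
  assumes "f - cst c * u \<in> I" "v - cst d * u \<in> I" "v \<notin> I"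
  shows "\<exists>e. f - cst e * v \<in> I"
proof -
  have "d \<noteq> 0" using assms(2,3) by auto
  have "(f - cst c * u) - cst (c / d) * (v - cst d * u) \<in> I"
    by (rule I_diff[OF assms(1) I_mult[OF assms(2)]])
  moreover have "cst (c / d) * cst d = (cst c :: ('x, 'k) mpoly)"
    using \<open>d \<noteq> 0\<close> by (simp add: cst_mult[symmetric])
  then have "(f - cst c * u) - cst (c / d) * (v - cst d * u) = f - cst (c / d) * v"
    by (simp only: right_diff_distrib mult.assoc[symmetric]) simp
  ultimately show ?thesis by auto
qed

lemma multiples_on_line_base:
  assumes "multiples_on_line z i" "f0 \<in> forms i" "f0 * z \<notin> I" "f \<in> forms i"
  shows "\<exists>c. f * z - cst c * (f0 * z) \<in> I"
proof -
  obtain u where u: "\<forall>f\<in>forms i. \<exists>c. f * z - cst c * u \<in> I"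
    using assms(1) unfolding multiples_on_line_def by blast
  obtain c d where "f * z - cst c * u \<in> I" "f0 * z - cst d * u \<in> I" using u assms(2,4) by blast
  then show ?thesis by (rule multiple_trans[OF _ _ assms(3)])
qed

text \<open>
  The first step of Macaulay's growth bound. If \<open>zA\<^sub>i\<close> is spanned by \<open>agz\<close> with \<open>a\<close> linear, then \<open>bgz\<close> is a
  multiple of \<open>agz\<close> for each linear \<open>b\<close>, so that \<open>b \<cdot> agz = a \<cdot> bgz\<close> is a multiple of \<open>a\<^sup>2gz\<close>. Here
  \<open>i \<ge> 1\<close> is needed to split off \<open>a\<close>.
\<close>

lemma multiples_on_line_Suc:
  assumes z: "z \<in> forms m" "z \<notin> I" and i: "1 \<le> i" "i \<le> m" and p: "multiples_on_line z i"
  shows "multiples_on_line z (Suc i)"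
proof -
  obtain j where j: "i = Suc j" using i by (cases i) auto
  obtain g where g: "g \<in> forms j" "g * z \<notin> I" using ex_mult_notin[OF z(1), of j] z(2) i j by auto
  have "g * z \<in> forms (j + m)" by (rule forms_mult[OF g(1) z(1)])
  then obtain a where a: "a \<in> forms 1" "a * (g * z) \<notin> I"
    using ex_linear_notin[of "g * z" "j + m"] g(2) i j by auto
  have ag: "a * g \<in> forms i" "a * g * z \<notin> I" using forms_one_mult[OF a(1) g(1)] a(2) j by (auto simp: mult.assoc)
  define u where "u = a * (a * g * z)"
  have gen: "\<exists>c. (b * f) * z - cst c * u \<in> I" if b: "b \<in> forms 1" and f: "f \<in> forms i" for b f
  proof -
    obtain c where c: "f * z - cst c * (a * g * z) \<in> I" using multiples_on_line_base[OF p ag f] by blast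
    have "b * g \<in> forms i" using forms_one_mult[OF b g(1)] j by simp
    then obtain d where d: "b * g * z - cst d * (a * g * z) \<in> I" using multiples_on_line_base[OF p ag] by blast
    have "b * (f * z - cst c * (a * g * z)) + (cst c * a) * (b * g * z - cst d * (a * g * z)) \<in> I"
      by (rule I_add[OF I_mult[OF c] I_mult[OF d]])
    moreover have "b * (f * z - cst c * (a * g * z)) + (cst c * a) * (b * g * z - cst d * (a * g * z))
        = (b * f) * z - (cst c * cst d) * u"
      by (simp add: u_def algebra_simps)
    ultimately have "(b * f) * z - cst (c * d) * u \<in> I" by (simp only: cst_mult)
    then show ?thesis by blast
  qed
  have "\<exists>c. f * z - cst c * u \<in> I" if "f \<in> forms (Suc i)" for f
    using forms_Suc_span[OF that]
  proof (induction rule: mp.span_induct_alt)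
    case base
    show ?case using I_zero by (intro exI[of _ 0]) simp
  next
    case (step e x f)
    then obtain c d where c: "x * z - cst c * u \<in> I" and d: "f * z - cst d * u \<in> I" using gen by blast
    have "cst e * (x * z - cst c * u) + (f * z - cst d * u) \<in> I" by (rule I_add[OF I_mult[OF c] d])
    moreover have "cst e * (x * z - cst c * u) + (f * z - cst d * u) = (cst e * x + f) * z - cst (e * c + d) * u"
      by (simp only: cst_add cst_mult) (simp add: algebra_simps)
    ultimately show ?case by auto
  qed
  then show ?thesis unfolding multiples_on_line_def by blast
qed

text \<open>
  Symmetry of the Hilbert function of \<open>zA\<close>. If \<open>zA\<^sub>m\<close> is spanned by \<open>u\<close>, then the pairing
  \<open>zA\<^sub>1 \<times> A\<^sub>m \<rightarrow> A\<^sub>2\<^sub>m\<^sub>+\<^sub>1\<close> factors through \<open>az \<mapsto> au\<close>, which takes values in a line. As the pairing is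
  nondegenerate, \<open>zA\<^sub>1\<close> has dimension at most one.
\<close>

lemma rank_le_one_if_multiples_on_line_middle:
  assumes z: "z \<in> forms m" "z \<notin> I" and p: "multiples_on_line z m"
  shows "rank_le_one z"
proof -
  obtain f0 where f0: "f0 \<in> forms m" "f0 * z \<notin> I" using ex_mult_notin[OF z(1), of m] z(2) by auto
  define u where "u = f0 * z"
  have u: "u \<in> forms (2 * m)" using forms_mult[OF f0(1) z(1)] by (simp add: u_def mult_2)
  have detect: "a * z \<in> I" if a: "a \<in> forms 1" "a * u \<in> I" for a
  proof (rule ccontr)
    assume n: "a * z \<notin> I"
    obtain g where g: "g \<in> forms m" "g * (a * z) \<notin> I"
      using ex_mult_notin[OF forms_one_mult[OF a(1) z(1)], of m] n by auto
    obtain c where c: "g * z - cst c * u \<in> I" using multiples_on_line_base[OF p f0 g(1)] u_def by blast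
    have "a * (g * z - cst c * u) + cst c * (a * u) \<in> I" by (rule I_add[OF I_mult[OF c] I_mult[OF a(2)]])
    then show False using g(2) by (simp add: algebra_simps)
  qed
  show ?thesis
    unfolding rank_le_one_def
  proof (intro ballI impI)
    fix a b :: "('x, 'k) mpoly" assume ab: "a \<in> forms 1" "b \<in> forms 1" "a * z \<notin> I"
    have "a * u \<notin> I" using detect ab by blast
    moreover have "a * u \<in> forms (2 * m + 1)" "b * u \<in> forms (2 * m + 1)"
      using forms_one_mult[OF ab(1) u] forms_one_mult[OF ab(2) u] by (simp_all only: Suc_eq_plus1)
    ultimately obtain c where "b * u - cst c * (a * u) \<in> I" using top_one_dimensional by blast
    then have "(b - cst c * a) * u \<in> I" by (simp add: algebra_simps)
    then have "(b - cst c * a) * z \<in> I" using ab by (intro detect) (auto intro: forms_diff forms_scale)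
    then show "\<exists>c. (b - cst c * a) * z \<in> I" by blast
  qed
qed

lemma not_multiples_on_line:
  assumes z: "z \<in> forms m" "z \<notin> I" "\<not> rank_le_one z" and i: "1 \<le> i" "i \<le> m"
  shows "\<not> multiples_on_line z i"
proof
  assume p: "multiples_on_line z i"
  have "multiples_on_line z m"
    using i(2)
  proof (induction rule: dec_induct)
    case base
    show ?case by (rule p)
  next
    case (step n)
    then show ?case using multiples_on_line_Suc[OF z(1,2), of n] i by auto
  qed
  then show False using rank_le_one_if_multiples_on_line_middle z by blast
qed

text \<open>
  If \<open>zA\<^sub>1\<close> has dimension at least two, then so does \<open>zA\<^sub>i\<close> for \<open>1 \<le> i \<le> m\<close>, and this is the
  codimension of the annihilator of \<open>z\<close> in degree \<open>i\<close>.
\<close>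

lemma dim_annihilator_le:
  assumes z: "z \<in> forms m" "z \<notin> I" "\<not> rank_le_one z" and i: "1 \<le> i" "i \<le> m"
  shows "mp.dim {f \<in> forms i. f * z \<in> I} + 2 \<le> mp.dim (forms i :: ('x, 'k) mpoly set)"
proof -
  let ?J = "I \<inter> forms (m + i)"
  let ?E = "add_multiples ?J i z"
  have np: "\<not> multiples_on_line z i" by (rule not_multiples_on_line[OF z i])
  have E: "?E \<subseteq> forms (m + i)" by (rule add_multiples_subset_forms[OF _ z(1)]) auto
  have f: "mp.fin_spanned S" if "S \<subseteq> forms (m + i)" for S :: "('x, 'k) mpoly set"
    by (rule mp.fin_spanned_subset[OF fin_spanned_forms that])
  obtain f0 where f0: "f0 \<in> forms i" "f0 * z \<notin> I"
    using np I_zero unfolding multiples_on_line_def by (metis diff_zero mult_zero_right)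
  obtain f1 where f1: "f1 \<in> forms i" "f1 * z \<notin> mp.span (insert (f0 * z) ?J)"
  proof (rule ccontr)
    assume "\<not> thesis"
    then have "\<forall>f\<in>forms i. f * z \<in> mp.span (insert (f0 * z) ?J)" using that by blast
    then have "multiples_on_line z i" unfolding multiples_on_line_def mp.span_breakdown_eq span_I_part by blast
    then show False using np by blast
  qed
  have in_forms: "f0 * z \<in> forms (m + i)" "f1 * z \<in> forms (m + i)"
    using forms_mult[OF f0(1) z(1)] forms_mult[OF f1(1) z(1)] by (auto simp: add.commute)
  have "mp.dim (insert (f0 * z) ?J) = Suc (mp.dim ?J)"
    by (rule mp.dim_insert_fin[OF f]) (use f0 in auto)
  moreover have "mp.dim (insert (f1 * z) (insert (f0 * z) ?J)) = Suc (mp.dim (insert (f0 * z) ?J))"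
    by (rule mp.dim_insert_fin[OF f]) (use f1 in_forms in auto)
  moreover have "mp.dim (insert (f1 * z) (insert (f0 * z) ?J)) \<le> mp.dim ?E"
  proof (rule mp.dim_mono_fin[OF f[OF E] subset_trans[OF _ mp.span_superset]])
    show "insert (f1 * z) (insert (f0 * z) ?J) \<subseteq> ?E"
      using f0(1) f1(1) by (auto simp: add_multiples_def mult.commute)
  qed
  moreover have "{f \<in> forms i. z * f \<in> ?J} = {f \<in> forms i. f * z \<in> I}"
    using forms_mult[OF z(1), of _ i] by (auto simp: mult.commute)
  ultimately show ?thesis using dim_colon[OF I_part_subspace, of "m + i" m i z] by simp
qed

section \<open>Deforming the powers of a generic linear form\<close>

text \<open>
  The rank of \<open>l\<^sup>s\<^sup>+\<^sup>1\<close> from \<open>A\<^sub>m\<^sub>-\<^sub>s\<close> to \<open>A\<^sub>m\<^sub>+\<^sub>1\<close> is the largest among all linear forms.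
\<close>

definition max_rank :: "('x, 'k) mpoly \<Rightarrow> nat \<Rightarrow> bool" where
  "max_rank l s \<longleftrightarrow> (\<forall>y\<in>forms 1.
     mp.dim (add_multiples (I \<inter> forms (Suc m)) (m - s) (y ^ (s + 1)))
       \<le> mp.dim (add_multiples (I \<inter> forms (Suc m)) (m - s) (l ^ (s + 1))))"

lemma generic_max_rank: "s \<le> m \<Longrightarrow> generic (\<lambda>l. max_rank l s)"
  unfolding max_rank_def by (rule generic_max_dim) (auto simp: plus_1_eq_Suc)

lemma coeff_in_image:
  assumes s: "s \<le> m" and l: "l \<in> forms 1" "max_rank l s" and b: "b \<in> forms 1"
    and q: "w \<in> forms (m - s)" "w' \<in> forms (m - s)"
    and low: "\<And>j. j < k \<Longrightarrow> coeff ([:l, b:] ^ (s + 1) * [:w, w':]) j \<in> I \<inter> forms (Suc m)"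
  shows "\<exists>u\<in>forms (m - s). coeff ([:l, b:] ^ (s + 1) * [:w, w':]) k - l ^ (s + 1) * u \<in> I"
proof -
  let ?p = "[:l, b:] ^ (s + 1) * [:w, w':]"
  have "coeff ?p k \<in> mp.span (add_multiples (I \<inter> forms (Suc m)) (m - s) (l ^ (s + 1)))"
  proof (rule coeff_in_image_of_max_dim[OF I_part_subspace _ l(1) b])
    show "I \<inter> forms (Suc m) \<subseteq> forms (s + 1 + (m - s))" using s by (auto simp: plus_1_eq_Suc)
    show "mp.dim (add_multiples (I \<inter> forms (Suc m)) (m - s) (y ^ (s + 1)))
       \<le> mp.dim (add_multiples (I \<inter> forms (Suc m)) (m - s) (l ^ (s + 1)))" if "y \<in> forms 1" for y
      using l(2) that unfolding max_rank_def by blast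
    show "coeff ?p j \<in> I \<inter> forms (Suc m)" if "j < k" for j using low[OF that] .
    fix t
    have "w + cst t * w' \<in> forms (m - s)" by (rule forms_line[OF q])
    moreover have "ev ?p t = (l + cst t * b) ^ (s + 1) * (w + cst t * w')"
      by (simp add: poly_power algebra_simps)
    ultimately show "ev ?p t \<in> mp.span (add_multiples (I \<inter> forms (Suc m)) (m - s) ((l + cst t * b) ^ (s + 1)))"
      by (auto simp: add_multiples_def intro: mp.span_base)
  qed
  then obtain u where "u \<in> forms (m - s)" "coeff ?p k - l ^ (s + 1) * u \<in> I \<inter> forms (Suc m)"
    by (rule span_add_multiplesE[OF _ I_part_subspace])
  then show ?thesis by blast
qed

text \<open>
  The coefficient of \<open>t\<close> in \<open>(l + tb)\<^sup>s\<^sup>+\<^sup>1w\<close>, for \<open>w\<close> in the kernel at \<open>t = 0\<close>.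
\<close>

lemma first_order:
  assumes s: "s \<le> m" and l: "l \<in> forms 1" "max_rank l s" and b: "b \<in> forms 1"
    and w: "w \<in> forms (m - s)" "l ^ (s + 1) * w \<in> I"
  shows "\<exists>u\<in>forms (m - s). of_nat (s + 1) * (l ^ s * b * w) - l ^ (s + 1) * u \<in> I"
proof -
  let ?p = "[:l, b:] ^ (s + 1) * [:w, 0:]"
  have c: "coeff ?p j = w * coeff ([:l, b:] ^ (s + 1)) j" for j by simp
  have "l ^ (s + 1) * w \<in> forms (s + 1 + (m - s))" by (rule forms_mult[OF forms_power_one[OF l(1)] w(1)])
  then have "coeff ?p j \<in> I \<inter> forms (Suc m)" if "j < 1" for j
    unfolding c using that w(2) s by (simp add: coeff_linear_poly_power mult.commute plus_1_eq_Suc)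
  then obtain u where u: "u \<in> forms (m - s)" "coeff ?p 1 - l ^ (s + 1) * u \<in> I"
    using coeff_in_image[OF s l b w(1) forms_zero, of 1] by blast
  have "coeff ([:l, b:] ^ (s + 1)) 1 = of_nat (s + 1) * b * l ^ s"
    by (simp add: coeff_linear_poly_power choose_one)
  then have "coeff ?p 1 = of_nat (s + 1) * (l ^ s * b * w)"
    unfolding c by (simp only: ac_simps)
  then show ?thesis using u by auto
qed

end

section \<open>The structure of a large kernel\<close>

text \<open>
  A generic linear form \<open>l\<close> whose kernel on \<open>A\<^sub>m\<close> is the line spanned by \<open>z\<close>, with \<open>zA\<^sub>1\<close> of dimension at
  least two. The assumptions turn out to be contradictory.
\<close>

locale large_kernel_ideal = gorenstein_data I m
  for I :: "('x::finite, 'k::field_char_0) mpoly set" and m +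
  fixes l z :: "('x, 'k) mpoly"
  assumes l: "l \<in> forms 1" and z: "z \<in> forms m" "z \<notin> I" "l * z \<in> I"
    and kernel: "f \<in> forms m \<Longrightarrow> l * f \<in> I \<Longrightarrow> \<exists>c. f - cst c * z \<in> I"
    and large: "\<not> rank_le_one z"
    and l_max_rank: "s < m \<Longrightarrow> max_rank l s"
begin

text \<open>
  If \<open>lf = 0\<close> with \<open>f\<close> of degree \<open>m - 1\<close>, then \<open>fA\<^sub>1\<close> lies in the kernel, hence in the line of \<open>z\<close>. If \<open>f\<close> is
  nonzero, then \<open>z\<close> is a multiple of some \<open>xf\<close>, and \<open>az\<close> is up to a scalar \<open>x \<cdot> af\<close>, a multiple of
  \<open>xz\<close>, for every linear \<open>a\<close>. This makes \<open>zA\<^sub>1\<close> a line.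
\<close>

lemma l_mult_inj_pred:
  assumes f: "f \<in> forms (m - 1)" "l * f \<in> I"
  shows "f \<in> I"
proof (rule ccontr)
  assume "f \<notin> I"
  then obtain x where x: "x \<in> forms 1" "x * f \<notin> I" using ex_linear_notin[OF f(1), OF _ \<open>f \<notin> I\<close>] by fastforce
  have K: "\<exists>c. b * f - cst c * z \<in> I" if b: "b \<in> forms 1" for b
  proof (rule kernel)
    show "b * f \<in> forms m" using forms_one_mult[OF b f(1)] m_pos by simp
    show "l * (b * f) \<in> I" using I_mult[OF f(2), of b] by (simp add: ac_simps)
  qed
  obtain c where c: "x * f - cst c * z \<in> I" using K[OF x(1)] by blast
  have "c \<noteq> 0" using c x(2) by auto
  have "\<exists>e. a * z - cst e * (x * z) \<in> I" if a: "a \<in> forms 1" for a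
  proof -
    obtain d where d: "a * f - cst d * z \<in> I" using K[OF a] by blast
    have "x * (a * f - cst d * z) - a * (x * f - cst c * z) \<in> I"
      by (rule I_diff[OF I_mult[OF d] I_mult[OF c]])
    moreover have "x * (a * f - cst d * z) - a * (x * f - cst c * z) = cst c * (a * z - cst (d / c) * (x * z))"
    proof -
      have "cst c * cst (d / c) = (cst d :: ('x, 'k) mpoly)" using \<open>c \<noteq> 0\<close> by (simp add: cst_mult[symmetric])
      then have "cst c * (a * z - cst (d / c) * (x * z)) = cst c * (a * z) - cst d * (x * z)"
        by (simp only: right_diff_distrib mult.assoc[symmetric])
      then show ?thesis by (simp add: algebra_simps)
    qed
    ultimately have "a * z - cst (d / c) * (x * z) \<in> I" using I_cancel \<open>c \<noteq> 0\<close> by simp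
    then show ?thesis by blast
  qed
  then show False using rank_le_oneI large by blast
qed

lemma l_mult_inj:
  assumes "i < m" "f \<in> forms i" "l * f \<in> I"
  shows "f \<in> I"
proof (rule ccontr)
  assume "f \<notin> I"
  then obtain g where g: "g \<in> forms (m - 1 - i)" "g * f \<notin> I"
    using ex_mult_notin[OF assms(2) _ \<open>f \<notin> I\<close>, of "m - 1 - i"] assms(1) by fastforce
  have "g * f \<in> forms (m - 1)" using forms_mult[OF g(1) assms(2)] assms(1) by simp
  moreover have "l * (g * f) \<in> I" using I_mult[OF assms(3), of g] by (simp add: ac_simps)
  ultimately show False using l_mult_inj_pred g(2) by blast
qed

lemma l_power_mult_inj:
  "f \<in> forms i \<Longrightarrow> i + s \<le> m \<Longrightarrow> l ^ s * f \<in> I \<Longrightarrow> f \<in> I"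
proof (induction s)
  case (Suc s)
  have "l ^ s * f \<in> forms (s + i)" by (rule forms_mult[OF forms_power_one[OF l] Suc.prems(1)])
  then have "l ^ s * f \<in> I" using l_mult_inj[of "s + i" "l ^ s * f"] Suc.prems by (simp add: mult.assoc)
  then show ?case using Suc by simp
qed simp

lemma l_notin: "l \<notin> I"
  using l_mult_inj[of 0 1] forms_cst[of 1] m_pos one_notin by auto

text \<open>
  In these degrees \<open>lA\<close> has codimension \<open>(2i + 2) - 2i = 2\<close> by injectivity of \<open>l\<close>, and it is
  contained in the annihilator of \<open>z\<close>, which has codimension at least two.
\<close>

lemma annihilator_subset_l_multiples:
  assumes i: "2 \<le> i" "i \<le> m" and f: "f \<in> forms i" "f * z \<in> I"
  shows "\<exists>g\<in>forms (i - 1). f - l * g \<in> I"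
proof -
  obtain j where j: "i = Suc j" "1 \<le> j" using i by (cases i) auto
  let ?N = "\<lambda>i. mp.dim (forms i :: ('x, 'k) mpoly set)" and ?D = "\<lambda>i. mp.dim (I \<inter> forms i)"
  let ?E = "add_multiples (I \<inter> forms i) j l" and ?C = "{f \<in> forms i. f * z \<in> I}"
  have "{g \<in> forms j. l * g \<in> I \<inter> forms i} = I \<inter> forms j"
    using l_mult_inj[of j] forms_one_mult[OF l] j i I_mult by auto
  then have "?D j + mp.dim ?E = ?N j + ?D i"
    using dim_colon[OF I_part_subspace, of i 1 j l] j by (simp add: plus_1_eq_Suc)
  then have "mp.dim ?E + 2 = ?N i" using hilbert[of j] hilbert[of i] i j by simp
  moreover have "mp.dim ?C + 2 \<le> ?N i" using dim_annihilator_le[OF z(1,2) large, of i] i by simp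
  ultimately have le: "mp.dim ?C \<le> mp.dim ?E" by simp
  have "l * g \<in> forms i \<and> l * g * z \<in> I" if "g \<in> forms j" for g
    using forms_one_mult[OF l that] j(1) I_mult[OF z(3), of g] by (simp add: ac_simps)
  then have sub: "?E \<subseteq> ?C" using I_mult' by (auto simp: add_multiples_def)
  have fin: "mp.fin_spanned ?C" by (rule mp.fin_spanned_subset[OF fin_spanned_forms, of _ i]) auto
  have "?C \<subseteq> mp.span ?E"
    by (rule mp.subspace_eq_of_dim[OF fin subset_trans[OF sub mp.span_superset] le])
  then have "f \<in> mp.span ?E" using f by blast
  then obtain g where "g \<in> forms j" "f - l * g \<in> I \<inter> forms i" by (rule span_add_multiplesE[OF _ I_part_subspace])
  then show ?thesis using j by auto
qed

text \<open>
  To first order in \<open>t\<close>, deforming \<open>l\<^sup>s\<^sup>+\<^sup>1w = 0\<close> in the direction \<open>b\<close> gives \<open>l\<^sup>s((s + 1)bw - lu) = 0\<close>. Since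
  the kernel of \<open>l\<^sup>s\<close> in this degree is spanned by \<open>lw\<close>, the bracket is a multiple of \<open>lw\<close>, and \<open>s + 1\<close>
  is invertible.
\<close>

lemma linear_mult_factor:
  assumes s: "s < m" and w: "w \<in> forms (m - s)" "z - l ^ s * w \<in> I" and b: "b \<in> forms 1"
  shows "\<exists>u\<in>forms (m - s). b * w - l * u \<in> I"
proof -
  have "l * z - l * (z - l ^ s * w) \<in> I" by (rule I_diff[OF z(3) I_mult[OF w(2)]])
  then have "l ^ (s + 1) * w \<in> I" by (simp add: power_add algebra_simps)
  then obtain u where u: "u \<in> forms (m - s)" "of_nat (s + 1) * (l ^ s * b * w) - l ^ (s + 1) * u \<in> I"
    using first_order[of s l b w] s l l_max_rank b w by auto
  define c where "c = (of_nat (s + 1) :: 'k)"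
  have c0: "c \<noteq> 0" unfolding c_def of_nat_eq_0_iff by simp
  have cc: "of_nat (s + 1) = (cst c :: ('x, 'k) mpoly)" unfolding c_def by (rule single_of_nat[symmetric])
  have eq: "of_nat (s + 1) * (l ^ s * b * w) - l ^ (s + 1) * u = l ^ s * (cst c * (b * w) - l * u)"
    unfolding cc by (simp add: power_add algebra_simps)
  have "\<exists>u\<in>forms (m - s). cst c * (b * w) - l * u \<in> I"
  proof (cases s)
    case 0
    then show ?thesis using u eq by auto
  next
    case (Suc r)
    let ?Y = "cst c * (b * w) - l * u"
    have Y: "?Y \<in> forms (Suc (m - s))"
      by (intro forms_diff forms_scale forms_one_mult b l w u)
    have "l ^ r * ?Y \<in> forms (r + Suc (m - s))" by (rule forms_mult[OF forms_power_one[OF l] Y])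
    then have "l ^ r * ?Y \<in> forms m" using Suc s by simp
    moreover have "l * (l ^ r * ?Y) \<in> I" using u(2) unfolding eq by (simp add: Suc mult.assoc)
    ultimately obtain e where e: "l ^ r * ?Y - cst e * z \<in> I" using kernel by blast
    have "(l ^ r * ?Y - cst e * z) + cst e * (z - l ^ s * w) \<in> I" by (rule I_add[OF e I_mult[OF w(2)]])
    moreover have "(l ^ r * ?Y - cst e * z) + cst e * (z - l ^ s * w) = l ^ r * (cst c * (b * w) - l * (u + cst e * w))"
      by (simp add: Suc algebra_simps)
    ultimately have "l ^ r * (cst c * (b * w) - l * (u + cst e * w)) \<in> I" by simp
    moreover have uf: "u + cst e * w \<in> forms (m - s)" by (intro forms_add forms_scale w u)
    moreover have "cst c * (b * w) - l * (u + cst e * w) \<in> forms (Suc (m - s))"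
      by (intro forms_diff forms_scale forms_one_mult b l w uf)
    ultimately have "cst c * (b * w) - l * (u + cst e * w) \<in> I"
      using l_power_mult_inj[of _ "Suc (m - s)" r] Suc s by simp
    then show ?thesis using uf by blast
  qed
  then obtain u' where u': "u' \<in> forms (m - s)" "cst c * (b * w) - l * u' \<in> I" by blast
  have "cst (inverse c) * (cst c * (b * w) - l * u') \<in> I" by (rule I_mult[OF u'(2)])
  moreover have "cst (inverse c) * (cst c * (b * w) - l * u') = b * w - l * (cst (inverse c) * u')"
    unfolding right_diff_distrib cst_inverse_cancel[OF c0] by (simp add: mult.left_commute)
  ultimately show ?thesis using forms_scale[OF u'(1)] by auto
qed

lemma factor_annihilates:
  assumes s: "s < m" and w: "w \<in> forms (m - s)" "z - l ^ s * w \<in> I"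
  shows "w * z \<in> I"
proof (rule socle_top)
  show "w * z \<in> forms (m - s + m)" by (rule forms_mult[OF w(1) z(1)])
  show "m - s + m \<le> 2 * m" by simp
  fix b :: "('x, 'k) mpoly" assume "b \<in> forms 1"
  then obtain u where u: "b * w - l * u \<in> I" using linear_mult_factor[OF s w] by blast
  have "z * (b * w - l * u) + u * (l * z) \<in> I" by (rule I_add[OF I_mult[OF u] I_mult[OF z(3)]])
  then show "b * (w * z) \<in> I" by (simp add: algebra_simps)
qed

text \<open>
  As long as \<open>w\<close> has degree at least two, \<open>wz = 0\<close> makes \<open>w\<close> itself a multiple of \<open>l\<close>.
\<close>

lemma ex_power_factor: "s < m \<Longrightarrow> \<exists>w\<in>forms (m - s). z - l ^ s * w \<in> I"
proof (induction s)
  case 0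
  show ?case using z I_zero by (intro bexI[of _ z]) auto
next
  case (Suc s)
  then obtain w where w: "w \<in> forms (m - s)" "z - l ^ s * w \<in> I" by auto
  have "w * z \<in> I" using factor_annihilates[of s w] Suc.prems w by simp
  then obtain g where g: "g \<in> forms (m - s - 1)" "w - l * g \<in> I"
    using annihilator_subset_l_multiples[of "m - s" w] Suc.prems w(1) by fastforce
  have "(z - l ^ s * w) + l ^ s * (w - l * g) \<in> I" by (rule I_add[OF w(2) I_mult[OF g(2)]])
  then have "z - l ^ Suc s * g \<in> I" by (simp add: algebra_simps)
  then show ?case using g(1) by (intro bexI[of _ g]) (simp_all only: Suc_eq_plus1 diff_diff_left)
qed

text \<open>
  The second-order condition, with \<open>n = m - 1\<close>. The correction \<open>-mT\<close> of \<open>v\<close> is chosen to cancel the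
  coefficient of \<open>t\<close> in \<open>(l + tb)\<^sup>m(v - tmT)\<close>, because \<open>l\<^sup>m\<^sup>-\<^sup>1bv = l\<^sup>mT\<close>. The coefficient of \<open>t\<^sup>2\<close> is therefore in \<open>l\<^sup>mA\<^sub>1\<close>,
  which \<open>v\<close> kills. Its product with \<open>v\<close> reduces by \<open>bv = lT\<close> to \<open>zbT\<close> times
  the difference of the binomial coefficient \<open>m\<close> over \<open>2\<close> and \<open>m\<^sup>2\<close>, which is nonzero.
\<close>

lemma second_order:
  assumes n: "m = Suc n" and v: "v \<in> forms 1" "z - l ^ n * v \<in> I"
    and b: "b \<in> forms 1" and T: "T \<in> forms 1" "b * v - l * T \<in> I"
  shows "z * (b * T) \<in> I"
proof -
  have n': "n < m" using n by simp
  have lnv: "l ^ m * v \<in> I"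
  proof -
    have "l * z - l * (z - l ^ n * v) \<in> I" by (rule I_diff[OF z(3) I_mult[OF v(2)]])
    then show ?thesis by (simp add: n power_add algebra_simps)
  qed
  define d where "d = (of_nat (m choose 2) - of_nat (m * m) :: 'k)"
  have "m choose 2 < m * m"
    using m_pos by (auto simp: choose_two intro: le_less_trans[OF div_le_dividend])
  then have d0: "d \<noteq> 0" unfolding d_def using of_nat_eq_iff[where 'a='k] by (metis eq_iff_diff_eq_0 less_irrefl)
  let ?w = "- (of_nat m * T)"
  let ?p = "[:l, b:] ^ (n + 1) * [:v, ?w:]"
  have w: "?w \<in> forms 1" using forms_scale[OF T(1), of "of_nat m"] forms_neg by simp
  have n1: "n + 1 = m" using n by simp
  have cP: "coeff ([:l, b:] ^ (n + 1)) j = of_nat (m choose j) * b ^ j * l ^ (m - j)" for j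
  proof (cases "j \<le> m")
    case True
    then show ?thesis unfolding n1 by (rule coeff_linear_poly_power)
  next
    case False
    have "degree ([:l, b:] ^ m) \<le> degree [:l, b:] * m" by (rule degree_power_le)
    also have "\<dots> \<le> 1 * m" by (intro mult_right_mono) simp_all
    finally have "coeff ([:l, b:] ^ m) j = 0" using False by (intro coeff_eq_0) simp
    then show ?thesis using False unfolding n1 by (simp add: binomial_eq_0)
  qed
  have cp: "coeff ?p j = coeff ([:l, b:] ^ (n + 1)) j * v + (if j = 0 then 0 else coeff ([:l, b:] ^ (n + 1)) (j - 1) * ?w)" for j
    by (cases j) (simp_all add: coeff_pCons ac_simps)
  have coeff0: "coeff ?p 0 = l ^ m * v"
    unfolding cp cP by simp
  have coeff1: "coeff ?p 1 = of_nat m * l ^ n * (b * v - l * T)"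
    unfolding cp cP by (simp add: n choose_one algebra_simps)
  have coeff2: "coeff ?p 2 = of_nat (m choose 2) * (l ^ (m - 2) * b * b * v) - of_nat (m * m) * (l ^ n * b * T)"
    unfolding cp cP by (simp add: n choose_one power2_eq_square algebra_simps)
  have low: "coeff ?p j \<in> I \<inter> forms (Suc m)" if "j < 2" for j
  proof -
    have "l ^ m * v \<in> forms (m + 1)" by (rule forms_mult[OF forms_power_one[OF l] v(1)])
    then have 0: "coeff ?p 0 \<in> I \<inter> forms (Suc m)" using lnv unfolding coeff0 by (simp only: Suc_eq_plus1 Int_iff)
    have "b * v - l * T \<in> forms (1 + 1)" by (intro forms_diff forms_mult b v l T)
    then have "l ^ n * (b * v - l * T) \<in> forms (n + (1 + 1))" by (rule forms_mult[OF forms_power_one[OF l]])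
    then have "cst (of_nat m) * (l ^ n * (b * v - l * T)) \<in> forms (n + (1 + 1))" by (rule forms_scale)
    then have "coeff ?p 1 \<in> forms (n + (1 + 1))" unfolding coeff1 by (simp only: single_of_nat mult.assoc)
    then have "coeff ?p 1 \<in> forms (Suc m)" using n by simp
    moreover have "coeff ?p 1 \<in> I" unfolding coeff1 by (rule I_mult[OF T(2)])
    ultimately have 1: "coeff ?p 1 \<in> I \<inter> forms (Suc m)" by blast
    from that consider "j = 0" | "j = 1" by linarith
    then show ?thesis using 0 1 by cases simp_all
  qed
  have mn: "m - n = 1" using n by simp
  obtain u where u: "coeff ?p 2 - l ^ m * u \<in> I"
    using coeff_in_image[OF less_imp_le[OF n'] l l_max_rank[OF n'] b, unfolded mn, OF v(1) w low]
    unfolding n1 by blast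
  have "v * (coeff ?p 2 - l ^ m * u) + u * (l ^ m * v) \<in> I" by (rule I_add[OF I_mult[OF u] I_mult[OF lnv]])
  then have vc: "v * coeff ?p 2 \<in> I" by (simp add: algebra_simps)
  have sq: "of_nat (m choose 2) * (l ^ (m - 2) * b * b * v * v) - of_nat (m choose 2) * (l ^ n * v * b * T) \<in> I"
  proof (cases n)
    case 0
    then show ?thesis using I_zero n by (simp add: choose_two)
  next
    case (Suc q)
    have "of_nat (m choose 2) * (l ^ q * b * v) * (b * v - l * T) \<in> I" by (rule I_mult[OF T(2)])
    then show ?thesis using n Suc by (simp add: algebra_simps)
  qed
  have "(of_nat (m choose 2) - of_nat (m * m)) * (b * T) * (z - l ^ n * v)
      + (v * coeff ?p 2 - (of_nat (m choose 2) * (l ^ (m - 2) * b * b * v * v) - of_nat (m choose 2) * (l ^ n * v * b * T))) \<in> I"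
    by (rule I_add[OF I_mult[OF v(2)] I_diff[OF vc sq]])
  moreover have "(of_nat (m choose 2) - of_nat (m * m)) * (b * T) * (z - l ^ n * v)
      + (v * coeff ?p 2 - (of_nat (m choose 2) * (l ^ (m - 2) * b * b * v * v) - of_nat (m choose 2) * (l ^ n * v * b * T)))
    = (of_nat (m choose 2) - of_nat (m * m)) * (z * (b * T))"
    unfolding coeff2 by (simp add: algebra_simps)
  moreover have "of_nat (m choose 2) - of_nat (m * m) = (cst d :: ('x, 'k) mpoly)"
    by (simp only: d_def single_diff single_of_nat)
  ultimately have "cst d * (z * (b * T)) \<in> I" by simp
  then show ?thesis using I_cancel d0 by blast
qed

text \<open>
  Polarising \<open>zbT = 0\<close> gives \<open>z(aT + bS) = 0\<close> when \<open>av = lS\<close> and \<open>bv = lT\<close>. On the other hand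
  \<open>bvS = lTS = avT\<close>, and \<open>z\<close> is a multiple of \<open>v\<close>, so that also \<open>z(bS - aT) = 0\<close>. Hence \<open>2azT = 0\<close> for all \<open>a\<close>.
\<close>

lemma cofactor_annihilates:
  assumes n: "m = Suc n" and v: "v \<in> forms 1" "z - l ^ n * v \<in> I"
    and b: "b \<in> forms 1" and T: "T \<in> forms 1" "b * v - l * T \<in> I"
  shows "z * T \<in> I"
proof (rule socle_top)
  have ex_T: "\<exists>T\<in>forms 1. b * v - l * T \<in> I" if "b \<in> forms 1" for b
    using linear_mult_factor[of n v b] n v that by (simp add: One_nat_def)
  note second = second_order[OF n v]
  show "z * T \<in> forms (m + 1)" by (rule forms_mult[OF z(1) T(1)])
  show "m + 1 \<le> 2 * m" using m_pos by simp
  fix a :: "('x, 'k) mpoly" assume a: "a \<in> forms 1"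
  then obtain S where S: "S \<in> forms 1" "a * v - l * S \<in> I" using ex_T by blast
  have "(a * v - l * S) + (b * v - l * T) \<in> I" by (rule I_add[OF S(2) T(2)])
  then have "z * ((a + b) * (S + T)) \<in> I"
    using a b S T by (intro second forms_add) (auto simp: algebra_simps)
  from I_diff[OF I_diff[OF this second[OF a S]] second[OF b T]]
  have 1: "z * (a * T + b * S) \<in> I" by (simp add: algebra_simps)
  have "(z - l ^ n * v) * (b * S - a * T) + (l ^ n * S * (b * v - l * T) - l ^ n * T * (a * v - l * S)) \<in> I"
    by (rule I_add[OF I_mult'[OF v(2)] I_diff[OF I_mult[OF T(2)] I_mult[OF S(2)]]])
  then have 2: "z * (b * S - a * T) \<in> I" by (simp add: algebra_simps)
  from I_diff[OF 1 2] have "2 * (a * (z * T)) \<in> I" by (simp add: algebra_simps)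
  then have "cst 2 * (a * (z * T)) \<in> I" by simp
  then show "a * (z * T) \<in> I" by (rule I_cancel) simp
qed

text \<open>
  Every linear \<open>T\<close> with \<open>bv = lT\<close> lies in the span of \<open>l\<close> and \<open>v\<close>, since the annihilator of \<open>z\<close> in degree
  one has dimension at most two. Here \<open>v\<close> is not a multiple \<open>cl\<close>: otherwise \<open>T = cb\<close> is possible
  and \<open>bz = 0\<close> for all \<open>b\<close>. So \<open>bz = l\<^sup>mT\<close> is a multiple of \<open>l\<^sup>m\<^sup>+\<^sup>1\<close>.
\<close>

lemma contradiction: False
proof -
  define n where "n = m - 1"
  have n: "m = Suc n" "n < m" using m_pos by (auto simp: n_def)
  obtain v where v: "v \<in> forms 1" "z - l ^ n * v \<in> I"
    using ex_power_factor[of n] n by (auto simp: One_nat_def)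
  have lnv: "l ^ m * v \<in> I"
  proof -
    have "l * z - l * (z - l ^ n * v) \<in> I" by (rule I_diff[OF z(3) I_mult[OF v(2)]])
    then show ?thesis by (simp add: n power_add algebra_simps)
  qed
  have vz: "v * z \<in> I" using factor_annihilates[of n v] v n by (simp add: One_nat_def)
  have ex_T: "\<exists>T\<in>forms 1. b * v - l * T \<in> I" if "b \<in> forms 1" for b
    using linear_mult_factor[of n v b] v n that by (simp add: One_nat_def)
  note zT = cofactor_annihilates[OF n(1) v]
  let ?J = "I \<inter> forms 1"
  have dim_l: "mp.dim (insert l ?J) = Suc (mp.dim ?J)"
    using l_notin by (intro mp.dim_insert_fin[OF I_part_fin]) auto
  have v_notin: "v \<notin> mp.span (insert l ?J)"
  proof
    assume "v \<in> mp.span (insert l ?J)"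
    then obtain c where c: "v - cst c * l \<in> I" unfolding mp.span_breakdown_eq span_I_part by blast
    have "c \<noteq> 0"
    proof
      assume "c = 0"
      then have "(z - l ^ n * v) + l ^ n * v \<in> I" using c by (intro I_add[OF v(2)] I_mult) simp
      then show False using z(2) by simp
    qed
    have "b * z \<in> I" if b: "b \<in> forms 1" for b
    proof -
      have "b * v - l * (cst c * b) \<in> I" using I_mult[OF c, of b] by (simp add: algebra_simps)
      then have "z * (cst c * b) \<in> I" by (rule zT[OF b forms_scale[OF b]])
      then have "cst c * (b * z) \<in> I" by (simp add: ac_simps)
      then show ?thesis by (rule I_cancel) fact
    qed
    then show False using socle_top[OF z(1)] z(2) by auto
  qed
  have "mp.fin_spanned (insert l ?J)"
    using l by (intro mp.fin_spanned_subset[OF fin_spanned_forms, of _ 1]) auto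
  from mp.dim_insert_fin[OF this v_notin] have "mp.dim (insert v (insert l ?J)) = mp.dim ?J + 2"
    using dim_l by simp
  moreover have "mp.dim {f \<in> forms 1. f * z \<in> I} + 2 \<le> mp.dim ?J + 4"
    using dim_annihilator_le[OF z(1,2) large, of 1] hilbert[of 1] m_pos by simp
  ultimately have le: "mp.dim {f \<in> forms 1. f * z \<in> I} \<le> mp.dim (insert v (insert l ?J))" by simp
  have fin: "mp.fin_spanned {f \<in> forms 1. f * z \<in> I}"
    by (rule mp.fin_spanned_subset[OF fin_spanned_forms, of _ 1]) auto
  have sub: "insert v (insert l ?J) \<subseteq> {f \<in> forms 1. f * z \<in> I}"
    using v(1) l vz z(3) I_mult' by auto
  have ann: "{f \<in> forms 1. f * z \<in> I} \<subseteq> mp.span (insert v (insert l ?J))"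
    by (rule mp.subspace_eq_of_dim[OF fin subset_trans[OF sub mp.span_superset] le])
  have "\<exists>c. b * z - cst c * l ^ (m + 1) \<in> I" if b: "b \<in> forms 1" for b
  proof -
    obtain T where T: "T \<in> forms 1" "b * v - l * T \<in> I" using ex_T[OF b] by blast
    have "T \<in> mp.span (insert v (insert l ?J))" using ann zT[OF b T] T(1) by (auto simp: mult.commute)
    then obtain c e where ce: "T - cst c * v - cst e * l \<in> I"
      unfolding mp.span_breakdown_eq span_I_part by blast
    have "b * (z - l ^ n * v) + l ^ n * (b * v - l * T) + l ^ m * (T - cst c * v - cst e * l) + cst c * (l ^ m * v) \<in> I"
      by (intro I_add I_mult v(2) T(2) ce lnv)
    then have "b * z - cst e * l ^ (m + 1) \<in> I" by (simp add: n power_add algebra_simps)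
    then show ?thesis by blast
  qed
  then show False using rank_le_oneI large by blast
qed

end

section \<open>Multiplication maps of maximal rank\<close>

context gorenstein_data
begin

text \<open>
  If no linear form is bijective from \<open>A\<^sub>m\<close> to \<open>A\<^sub>m\<^sub>+\<^sub>1\<close>, then by \<open>hyperplane_section_le_one\<close> the kernel of each form of
  maximal rank is a line spanned by some \<open>z\<close> with \<open>z\<^sup>2 = 0\<close>, which \<open>rank_one_kernels_impossible\<close>
  and the locale \<open>large_kernel_ideal\<close> exclude.
\<close>

lemma ex_bijective_middle:
  "\<exists>l\<in>forms 1. (\<forall>f\<in>forms m. l * f \<in> I \<longrightarrow> f \<in> I) \<and>
     (\<forall>g\<in>forms (Suc m). \<exists>f\<in>forms m. g - l * f \<in> I)"
proof -
  let ?N = "\<lambda>i. mp.dim (forms i :: ('x, 'k) mpoly set)" and ?D = "\<lambda>i. mp.dim (I \<inter> forms i)"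
  let ?E = "\<lambda>l. add_multiples (I \<inter> forms (Suc m)) m l" and ?K = "\<lambda>l. {f \<in> forms m. l * f \<in> I \<inter> forms (Suc m)}"
  have E_forms: "?E l \<subseteq> forms (Suc m)" if "l \<in> forms 1" for l
    using add_multiples_subset_forms[of "I \<inter> forms (Suc m)" 1 m l] that by (simp add: plus_1_eq_Suc)
  have colon: "mp.dim (?K l) + mp.dim (?E l) = ?N m + ?D (Suc m)" for l
    using dim_colon[OF I_part_subspace, of "Suc m" 1 m l] by (simp add: plus_1_eq_Suc)
  have K_sub: "I \<inter> forms m \<subseteq> ?K l" if "l \<in> forms 1" for l
    using forms_one_mult[OF that] I_mult by auto
  have K_eq: "f \<in> ?K l" if "l \<in> forms 1" "f \<in> forms m" "l * f \<in> I" for l f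
    using forms_one_mult that by auto
  have fK: "mp.fin_spanned (?K l)" for l by (rule mp.fin_spanned_subset[OF fin_spanned_forms, of _ m]) auto
  note hm = hilbert[OF m_pos order_refl]
  obtain x0 where x0: "x0 \<in> forms 1" "?N (Suc m) \<le> mp.dim (?E x0) + 1"
    using hyperplane_section_le_one[OF I_part_subspace, of "Suc m" m] hilbert_middle by auto
  have "\<exists>l\<in>forms 1. ?N (Suc m) \<le> mp.dim (?E l)"
  proof (rule ccontr)
    assume neg: "\<not> ?thesis"
    let ?G = "\<lambda>l. \<forall>s\<in>{..<m}. max_rank l s"
    have gen: "generic ?G" by (rule generic_ball) (auto intro: generic_max_rank)
    have "\<exists>z\<in>forms m. z \<notin> I \<and> l * z \<in> I \<and> z * z \<in> I \<and> rank_le_one z"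
      if l: "l \<in> forms 1" and G: "?G l" for l
    proof -
      have max: "max_rank l s" if "s < m" for s using G that by simp
      have "max_rank l 0" using max m_pos by simp
      then have "mp.dim (?E x0) \<le> mp.dim (?E l)"
        using x0(1) unfolding max_rank_def by simp
      moreover have "\<not> ?N (Suc m) \<le> mp.dim (?E l)" using neg l by blast
      ultimately have dK: "mp.dim (?K l) = Suc (?D m)" using colon[of l] x0(2) hm hilbert_middle by linarith
      obtain z where z: "z \<in> ?K l" "z \<notin> I"
      proof (rule ccontr)
        assume "\<not> thesis"
        then have "?K l \<subseteq> I \<inter> forms m" using that by blast
        then have "mp.dim (?K l) \<le> ?D m" by (intro mp.dim_mono_fin[OF I_part_fin]) simp
        then show False using dK by simp
      qed
      have "mp.dim (insert z (I \<inter> forms m)) = Suc (?D m)"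
        by (rule mp.dim_insert_fin[OF I_part_fin]) (use z in auto)
      moreover have "insert z (I \<inter> forms m) \<subseteq> ?K l" using z(1) K_sub[OF l] by blast
      ultimately have "?K l \<subseteq> mp.span (insert z (I \<inter> forms m))"
        using dK by (intro mp.subspace_eq_of_dim[OF fK subset_trans[OF _ mp.span_superset]]) auto
      then have kernel: "\<exists>c. f - cst c * z \<in> I" if "f \<in> forms m" "l * f \<in> I" for f
      proof -
        have "f \<in> mp.span (insert z (I \<inter> forms m))" using \<open>?K l \<subseteq> _\<close> K_eq[OF l that] by blast
        then show ?thesis unfolding mp.span_breakdown_eq span_I_part by blast
      qed
      have z': "z \<in> forms m" "l * z \<in> I" using z by auto
      have "z * z \<in> I"
      proof (rule socle_top)
        show "z * z \<in> forms (m + m)" by (rule forms_mult[OF z'(1) z'(1)])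
        show "m + m \<le> 2 * m" by simp
        fix b :: "('x, 'k) mpoly" assume b: "b \<in> forms 1"
        obtain u where u: "b * z - l * u \<in> I"
          using first_order[of 0 l b z] l max[of 0] m_pos b z' by auto
        have "z * (b * z - l * u) + u * (l * z) \<in> I" by (rule I_add[OF I_mult[OF u] I_mult[OF z'(2)]])
        then show "b * (z * z) \<in> I" by (simp add: algebra_simps)
      qed
      moreover have "rank_le_one z"
      proof (rule ccontr)
        assume large: "\<not> rank_le_one z"
        interpret large_kernel_ideal I m l z
          by unfold_locales (use l z z' kernel large max in auto)
        show False by (rule contradiction)
      qed
      ultimately show ?thesis using z z' by blast
    qed
    then show False by (rule rank_one_kernels_impossible[OF gen])
  qed
  then obtain l where l: "l \<in> forms 1" "?N (Suc m) \<le> mp.dim (?E l)" by blast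
  have "mp.dim (?K l) \<le> ?D m" using colon[of l] l(2) hm hilbert_middle by linarith
  then have "?K l \<subseteq> mp.span (I \<inter> forms m)"
    by (rule mp.subspace_eq_of_dim[OF fK subset_trans[OF K_sub[OF l(1)] mp.span_superset]])
  then have inj: "f \<in> I" if "f \<in> forms m" "l * f \<in> I" for f
    using K_eq[OF l(1) that] by auto
  have "forms (Suc m) \<subseteq> mp.span (?E l)"
    by (rule mp.subspace_eq_of_dim[OF fin_spanned_forms _ l(2)]) (use E_forms[OF l(1)] in simp)
  then have "\<exists>f\<in>forms m. g - l * f \<in> I" if "g \<in> forms (Suc m)" for g
    using span_add_multiplesE[OF _ I_part_subspace, of g "Suc m" m l] that by blast
  then show ?thesis using l(1) inj by blast
qed

text \<open>
  Bijectivity in the middle spreads to all degrees: injectivity downwards, because a nonzero class of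
  lower degree has a nonzero multiple in \<open>A\<^sub>m\<close>, and surjectivity upwards, because \<open>A\<close> is generated in
  degree one.
\<close>

lemma ex_maximal_rank:
  "\<exists>l\<in>forms 1. \<forall>i. (\<forall>f\<in>forms i. l * f \<in> I \<longrightarrow> f \<in> I) \<or>
     (\<forall>g\<in>forms (Suc i). \<exists>f\<in>forms i. g - l * f \<in> I)"
proof -
  obtain l where l: "l \<in> forms 1" and inj: "\<And>f. f \<in> forms m \<Longrightarrow> l * f \<in> I \<Longrightarrow> f \<in> I"
    and surj: "\<And>g. g \<in> forms (Suc m) \<Longrightarrow> \<exists>f\<in>forms m. g - l * f \<in> I"
    using ex_bijective_middle by blast
  have "f \<in> I" if i: "i \<le> m" and f: "f \<in> forms i" "l * f \<in> I" for i f
  proof (rule ccontr)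
    assume "f \<notin> I"
    then obtain g where g: "g \<in> forms (m - i)" "g * f \<notin> I" using ex_mult_notin[OF f(1), of "m - i"] i by auto
    have "g * f \<in> forms m" using forms_mult[OF g(1) f(1)] i by simp
    moreover have "l * (g * f) \<in> I" using I_mult[OF f(2), of g] by (simp add: ac_simps)
    ultimately show False using inj g(2) by blast
  qed
  moreover have "\<exists>f\<in>forms i. g - l * f \<in> I" if "m \<le> i" "g \<in> forms (Suc i)" for i g
    using that
  proof (induction i arbitrary: g rule: dec_induct)
    case base
    then show ?case by (rule surj)
  next
    case (step i)
    note IH = step.IH
    show ?case
      using forms_Suc_span[OF step.prems]
    proof (induction rule: mp.span_induct_alt)
      case base
      show ?case using I_zero by (intro bexI[of _ 0]) auto
    next
      case (step c x g)
      then obtain a h where x: "x = a * h" "a \<in> forms 1" "h \<in> forms (Suc i)" by blast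
      obtain f where f: "f \<in> forms i" "h - l * f \<in> I" using IH[OF x(3)] by blast
      obtain f' where f': "f' \<in> forms (Suc i)" "g - l * f' \<in> I" using step by blast
      have "(cst c * a) * (h - l * f) + (g - l * f') \<in> I" by (rule I_add[OF I_mult[OF f(2)] f'(2)])
      then have "cst c * x + g - l * (cst c * (a * f) + f') \<in> I" by (simp add: x(1) algebra_simps)
      moreover have "cst c * (a * f) + f' \<in> forms (Suc i)"
        by (intro forms_add forms_scale forms_one_mult x f f')
      ultimately show ?case by blast
    qed
  qed
  ultimately show ?thesis using l by (meson nat_le_linear)
qed

end

section \<open>The quotient algebra\<close>

lemma poly_ring_simps [simp]:
  "carrier (poly_ring :: ('x::finite, 'k::field) mpoly ring) = UNIV"
  "f \<oplus>\<^bsub>poly_ring\<^esub> g = f + (g :: ('x, 'k) mpoly)"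
  "f \<otimes>\<^bsub>poly_ring\<^esub> g = f * g"
  "\<zero>\<^bsub>poly_ring\<^esub> = (0 :: ('x, 'k) mpoly)"
  "\<one>\<^bsub>poly_ring\<^esub> = (1 :: ('x, 'k) mpoly)"
  by (simp_all add: ring_of_type_algebra_def)

locale mpoly_ideal =
  fixes I :: "('x::finite, 'k::field) mpoly set"
  assumes ideal_I: "ideal I poly_ring"
begin

sublocale I: ideal I "poly_ring :: ('x, 'k) mpoly ring" by (rule ideal_I)

sublocale Q: ring "quot_alg I" by (rule I.quotient_is_ring)

lemma zero_mem: "0 \<in> I"
  using additive_subgroup.zero_closed[OF ideal.axioms(1)[OF ideal_I]] unfolding poly_ring_simps .

lemma add_mem: "f \<in> I \<Longrightarrow> g \<in> I \<Longrightarrow> f + g \<in> I"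
  using additive_subgroup.a_closed[OF ideal.axioms(1)[OF ideal_I], of f g] unfolding poly_ring_simps .

lemma mult_mem: "g \<in> I \<Longrightarrow> f * g \<in> I"
  using I.I_l_closed[of g f] unfolding poly_ring_simps by blast

lemma diff_mem: "f \<in> I \<Longrightarrow> g \<in> I \<Longrightarrow> f - g \<in> I"
  using add_mem[of f "(-1) * g"] mult_mem[of g "-1"] by simp

lemma residue_class_eq: "residue_class I f = {h + f | h. h \<in> I}"
  by (auto simp: residue_class_def a_r_coset_def r_coset_def)

lemma residue_class_eq_iff: "residue_class I f = residue_class I g \<longleftrightarrow> f - g \<in> I"
proof
  assume "residue_class I f = residue_class I g"
  moreover have "f \<in> residue_class I f" unfolding residue_class_eq using zero_mem by force
  ultimately have "f \<in> residue_class I g" by simp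
  then show "f - g \<in> I" unfolding residue_class_eq by auto
next
  assume d: "f - g \<in> I"
  have "h + f = (h + (f - g)) + g" "h + g = (h - (f - g)) + f" for h by simp_all
  then show "residue_class I f = residue_class I g"
    unfolding residue_class_eq using add_mem[OF _ d] diff_mem[OF _ d] by blast
qed

lemma carrier_quot: "carrier (quot_alg I) = range (residue_class I)"
  by (auto simp: FactRing_def A_RCOSETS_def' residue_class_def)

lemma residue_class_hom: "residue_class I \<in> ring_hom poly_ring (quot_alg I)"
  using I.rcos_ring_hom by (simp add: residue_class_def[abs_def])

lemma residue_class_mult: "residue_class I f \<otimes>\<^bsub>quot_alg I\<^esub> residue_class I g = residue_class I (f * g)"
  using ring_hom_mult[OF residue_class_hom, of f g] by simp

lemma residue_class_add: "residue_class I f \<oplus>\<^bsub>quot_alg I\<^esub> residue_class I g = residue_class I (f + g)"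
  using ring_hom_add[OF residue_class_hom, of f g] by simp

lemma residue_class_zero: "\<zero>\<^bsub>quot_alg I\<^esub> = residue_class I 0"
  by (simp add: FactRing_def residue_class_eq)

lemma residue_class_eq_zero_iff: "residue_class I f = \<zero>\<^bsub>quot_alg I\<^esub> \<longleftrightarrow> f \<in> I"
  by (simp add: residue_class_zero residue_class_eq_iff)

lemma residue_class_carrier [simp]: "residue_class I f \<in> carrier (quot_alg I)"
  by (simp add: carrier_quot)

lemma Span_residue_classes:
  "Q.Span (scalars I) (map (residue_class I) us) = residue_class I ` mp.span (set us)"
proof (induction us)
  case Nil
  show ?case by (simp add: residue_class_zero)
next
  case (Cons u us)
  have "Q.Span (scalars I) (map (residue_class I) (u # us))
      = Q.line_extension (scalars I) (residue_class I u) (residue_class I ` mp.span (set us))"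
    using Cons by simp
  also have "\<dots> = residue_class I ` mp.span (set (u # us))"
  proof (rule equalityI; rule subsetI)
    fix x assume "x \<in> Q.line_extension (scalars I) (residue_class I u) (residue_class I ` mp.span (set us))"
    then obtain c s where "s \<in> mp.span (set us)" "x = residue_class I (cst c * u + s)"
      unfolding Q.line_extension_mem_iff scalars_def by (auto simp: residue_class_mult residue_class_add)
    moreover from this have "cst c * u + s \<in> mp.span (set (u # us))"
      using mp.span_mono[of "set us" "set (u # us)"]
      by (intro mp.span_add mp.span_scale) (auto intro: mp.span_base)
    ultimately show "x \<in> residue_class I ` mp.span (set (u # us))" by blast
  next
    fix x assume "x \<in> residue_class I ` mp.span (set (u # us))"
    then obtain f where f: "f \<in> mp.span (insert u (set us))" "x = residue_class I f" by auto
    then obtain c where c: "f - cst c * u \<in> mp.span (set us)" unfolding mp.span_breakdown_eq by blast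
    have "x = residue_class I (cst c) \<otimes>\<^bsub>quot_alg I\<^esub> residue_class I u \<oplus>\<^bsub>quot_alg I\<^esub> residue_class I (f - cst c * u)"
      by (simp add: f(2) residue_class_mult residue_class_add)
    then show "x \<in> Q.line_extension (scalars I) (residue_class I u) (residue_class I ` mp.span (set us))"
      unfolding Q.line_extension_mem_iff scalars_def using c by blast
  qed
  finally show ?case .
qed

text \<open>
  A basis of a complement of \<open>I\<close> in the forms of degree \<open>i\<close>, built up one vector at a time, maps to
  a basis of the graded piece.
\<close>

lemma dim_forms_eq:
  assumes proper: "1 \<notin> I"
  shows "mp.dim (forms i :: ('x, 'k) mpoly set) = mp.dim (I \<inter> forms i) + hilbert_function I i"
proof -
  let ?J = "I \<inter> forms i" and ?N = "mp.dim (forms i :: ('x, 'k) mpoly set)"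
  have J_fin: "mp.fin_spanned ?J" by (rule mp.fin_spanned_subset[OF fin_spanned_forms, of _ i]) auto
  have le: "mp.dim ?J \<le> ?N" by (rule mp.dim_mono_fin[OF fin_spanned_forms]) simp
  have sub: "mp.subspace I"
    by (rule mp.subspaceI) (auto intro: zero_mem add_mem mult_mem)
  have K: "subfield (scalars I) (quot_alg I)" using scalars_subfield[OF ideal_I] proper by blast
  have "\<exists>us. length us = n \<and> set us \<subseteq> forms i \<and> Q.independent (scalars I) (map (residue_class I) us) \<and>
      mp.dim (?J \<union> set us) = mp.dim ?J + n" if "n \<le> ?N - mp.dim ?J" for n
    using that
  proof (induction n)
    case (Suc n)
    then obtain us where us: "length us = n" "set us \<subseteq> forms i"
      "Q.independent (scalars I) (map (residue_class I) us)" "mp.dim (?J \<union> set us) = mp.dim ?J + n" by auto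
    have U: "?J \<union> set us \<subseteq> forms i" using us by auto
    note fU = mp.fin_spanned_subset[OF fin_spanned_forms U]
    obtain u where u: "u \<in> forms i" "u \<notin> mp.span (?J \<union> set us)"
    proof (rule ccontr)
      assume "\<not> thesis"
      then have "forms i \<subseteq> mp.span (?J \<union> set us)" using that by blast
      then have "?N \<le> mp.dim (?J \<union> set us)" by (rule mp.dim_mono_fin[OF fU])
      then show False using us(4) Suc.prems by simp
    qed
    have "residue_class I u \<notin> residue_class I ` mp.span (set us)"
    proof
      assume "residue_class I u \<in> residue_class I ` mp.span (set us)"
      then obtain s where s: "s \<in> mp.span (set us)" "u - s \<in> I" by (auto simp: residue_class_eq_iff)
      then have "s \<in> forms i" using us(2) mp.span_mono[of "set us" "forms i"] by auto
      then have "u - s \<in> ?J" using s u forms_diff by blast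
      then have "(u - s) + s \<in> mp.span (?J \<union> set us)"
        using s(1) mp.span_mono[of "set us" "?J \<union> set us"] by (intro mp.span_add) (auto intro: mp.span_base)
      then show False using u(2) by simp
    qed
    then have "Q.independent (scalars I) (map (residue_class I) (u # us))"
      using us(3) Span_residue_classes[of us] by (auto intro: Q.independent.li_Cons)
    moreover have "mp.dim (?J \<union> set (u # us)) = mp.dim ?J + Suc n"
      using mp.dim_insert_fin[OF fU u(2)] us(4) by simp
    ultimately show ?case using us u by (intro exI[of _ "u # us"]) auto
  qed auto
  then obtain us where us: "length us = ?N - mp.dim ?J" "set us \<subseteq> forms i"
    "Q.independent (scalars I) (map (residue_class I) us)" "mp.dim (?J \<union> set us) = mp.dim ?J + (?N - mp.dim ?J)" by blast
  have "forms i \<subseteq> mp.span (?J \<union> set us)"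
    using us le by (intro mp.subspace_eq_of_dim[OF fin_spanned_forms]) auto
  have "Q.Span (scalars I) (map (residue_class I) us) = graded_piece I i"
    unfolding Span_residue_classes graded_piece_def
  proof (rule antisym; rule subsetI)
    fix x assume "x \<in> residue_class I ` mp.span (set us)"
    then show "x \<in> residue_class I ` forms i" using mp.span_mono[OF us(2)] by auto
  next
    fix x assume "x \<in> residue_class I ` forms i"
    then obtain f where f: "f \<in> forms i" "x = residue_class I f" by blast
    then have "f \<in> mp.span (?J \<union> set us)" using \<open>forms i \<subseteq> _\<close> by blast
    then obtain j s where "f = j + s" "j \<in> mp.span ?J" "s \<in> mp.span (set us)" unfolding mp.span_Un by blast
    moreover have "mp.span ?J \<subseteq> I" by (rule mp.span_minimal[OF _ sub]) auto
    ultimately have "residue_class I f = residue_class I s" by (auto simp: residue_class_eq_iff)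
    then show "x \<in> residue_class I ` mp.span (set us)" using f \<open>s \<in> _\<close> by blast
  qed
  then have "Q.dimension (length us) (scalars I) (graded_piece I i)"
    using Q.dimensionI[OF K us(3)] by simp
  then have "hilbert_function I i = length us"
    using Q.dimI[OF K] by (simp add: hilbert_function_def over_def)
  then show ?thesis using us(1) le by simp
qed

text \<open>
  The irrelevant ideal is generated by the linear forms, and the annihilator of a class is an ideal.
\<close>

lemma mem_socle:
  assumes "\<And>a. a \<in> forms 1 \<Longrightarrow> a * f \<in> I"
  shows "residue_class I f \<in> socle I"
proof -
  let ?f = "residue_class I f"
  let ?A = "{b \<in> carrier (quot_alg I). b \<otimes>\<^bsub>quot_alg I\<^esub> ?f = \<zero>\<^bsub>quot_alg I\<^esub>}"
  have mem: "residue_class I g \<in> ?A \<longleftrightarrow> g * f \<in> I" for g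
    by (simp add: residue_class_mult residue_class_eq_zero_iff)
  have A: "?A = residue_class I ` {g. g * f \<in> I}" using mem carrier_quot by auto
  have "ideal ?A (quot_alg I)"
  proof (rule idealI[OF Q.ring_axioms])
    show "subgroup ?A (add_monoid (quot_alg I))"
    proof (rule Q.add.subgroupI)
      show "?A \<subseteq> carrier (quot_alg I)" by auto
      show "?A \<noteq> {}" unfolding A using zero_mem by (auto intro!: exI[of _ 0])
      fix a assume "a \<in> ?A"
      then obtain g where g: "a = residue_class I g" "g * f \<in> I" unfolding A by blast
      have "\<ominus>\<^bsub>quot_alg I\<^esub> a = residue_class I (- g)"
        by (rule Q.minus_equality) (auto simp: g residue_class_add residue_class_zero)
      moreover have "(- g) * f \<in> I" using mult_mem[OF g(2), of "-1"] by simp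
      ultimately show "\<ominus>\<^bsub>quot_alg I\<^esub> a \<in> ?A" using mem by simp
      fix b assume "b \<in> ?A"
      then obtain h where h: "b = residue_class I h" "h * f \<in> I" unfolding A by blast
      have "(g + h) * f \<in> I" using add_mem[OF g(2) h(2)] by (simp add: algebra_simps)
      then show "a \<oplus>\<^bsub>quot_alg I\<^esub> b \<in> ?A" using mem by (simp add: g h residue_class_add)
    qed
    fix a x assume "a \<in> ?A" "x \<in> carrier (quot_alg I)"
    then obtain g h where g: "a = residue_class I g" "g * f \<in> I" and h: "x = residue_class I h"
      unfolding A using carrier_quot by blast
    have "h * g * f \<in> I" using mult_mem[OF g(2), of h] by (simp add: mult.assoc)
    then show "x \<otimes>\<^bsub>quot_alg I\<^esub> a \<in> ?A" "a \<otimes>\<^bsub>quot_alg I\<^esub> x \<in> ?A"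
      using mem[of "h * g"] by (simp_all add: g h residue_class_mult mult.commute)
  qed
  moreover have "graded_piece I 1 \<subseteq> ?A"
    unfolding graded_piece_def A using assms by blast
  ultimately have "irrelevant_ideal I \<subseteq> ?A"
    unfolding irrelevant_ideal_def by (rule Q.genideal_minimal)
  then show ?thesis by (auto simp: socle_def)
qed

end

lemma lookup_form_part:
  "Poly_Mapping.lookup (form_part i f) k = (if mon_degree k = i then Poly_Mapping.lookup f k else 0)"
proof -
  have "Poly_Mapping.lookup (form_part i f) k
    = (\<Sum>t\<in>{t \<in> Poly_Mapping.keys f. mon_degree t = i}. if k = t then Poly_Mapping.lookup f t else 0)"
    unfolding form_part_def lookup_sum by (rule sum.cong) (auto simp: lookup_single when_def)
  then show ?thesis by (auto simp: in_keys_iff)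
qed

lemma form_part_diff:
  assumes "f \<in> forms i" "g \<in> forms j" "i \<noteq> j"
  shows "form_part i (f - g) = f"
  using assms by (intro poly_mapping_eqI) (auto simp: lookup_form_part lookup_minus forms_def in_keys_iff)

lemma has_socle_degree_unique:
  assumes "has_socle_degree I d" "has_socle_degree I e" shows "d = e"
  using assms unfolding has_socle_degree_def by (meson linorder_neqE_nat)

theorem theorem3p4:
  fixes I :: "('x::finite, 'k::{alg_closed_field, field_char_0}) mpoly set" and m :: nat
  assumes "m \<ge> 1"
    and "standard_graded_artinian I"
    and "gorenstein I"
    and "has_socle_degree I (2 * m + 1)"
    and "hilbert_function I 0 = 1"
    and "\<And>i. 1 \<le> i \<Longrightarrow> i \<le> m \<Longrightarrow> hilbert_function I i = 2 * i + 2"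
    and "\<And>i. i \<le> m \<Longrightarrow> hilbert_function I (2 * m + 1 - i) = hilbert_function I i"
  shows "weak_lefschetz I"
proof -
  have hom: "ideal I poly_ring" "\<And>f i. f \<in> I \<Longrightarrow> form_part i f \<in> I"
    using assms(2) by (auto simp: standard_graded_artinian_def homogeneous_ideal_def)
  interpret A: mpoly_ideal I by (rule mpoly_ideal.intro[OF hom(1)])
  have one: "1 \<notin> I"
  proof
    assume "1 \<in> I"
    then have "f \<in> I" for f using A.mult_mem[of 1 f] by simp
    then have "graded_piece I (2 * m + 1) = {\<zero>\<^bsub>quot_alg I\<^esub>}"
      unfolding graded_piece_def using A.residue_class_eq_zero_iff forms_zero by blast
    then show False using assms(4) by (simp add: has_socle_degree_def)
  qed
  note dims = A.dim_forms_eq[OF one]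
  have "f \<in> I" if f: "f \<in> forms i" "i \<le> 2 * m" "\<And>a. a \<in> forms 1 \<Longrightarrow> a * f \<in> I" for f i
  proof -
    have "residue_class I f \<in> graded_piece I (2 * m + 1)"
      using A.mem_socle[OF f(3)] assms(3,4) has_socle_degree_unique unfolding gorenstein_def by blast
    then obtain g where g: "g \<in> forms (2 * m + 1)" "f - g \<in> I"
      unfolding graded_piece_def by (auto simp: A.residue_class_eq_iff)
    have "form_part i (f - g) = f" using form_part_diff[OF f(1) g(1)] f(2) by simp
    then show ?thesis using hom(2)[OF g(2), of i] by simp
  qed
  moreover have "hilbert_function I (Suc m) = 2 * m + 2"
  proof -
    have e: "2 * m + 1 - m = Suc m" by simp
    show ?thesis using assms(7)[of m] assms(6)[of m] assms(1) unfolding e by simp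
  qed
  ultimately interpret G: gorenstein_data I m
    using assms(5,6) assms(7)[of 0] assms(1) one
    by unfold_locales (auto simp: dims A.zero_mem A.add_mem A.mult_mem)
  obtain l where l: "l \<in> forms 1" and rank: "\<And>i. (\<forall>f\<in>forms i. l * f \<in> I \<longrightarrow> f \<in> I) \<or>
     (\<forall>g\<in>forms (Suc i). \<exists>f\<in>forms i. g - l * f \<in> I)"
    using G.ex_maximal_rank by blast
  show ?thesis
    unfolding weak_lefschetz_def
  proof (intro bexI allI)
    show "residue_class I l \<in> graded_piece I 1" unfolding graded_piece_def using l by blast
    fix i
    let ?m = "\<lambda>a. residue_class I l \<otimes>\<^bsub>quot_alg I\<^esub> a"
    from rank[of i] show "inj_on ?m (graded_piece I i) \<or> ?m ` graded_piece I i = graded_piece I (Suc i)"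
    proof
      assume inj: "\<forall>f\<in>forms i. l * f \<in> I \<longrightarrow> f \<in> I"
      have "inj_on ?m (graded_piece I i)"
        unfolding graded_piece_def
      proof (rule inj_onI, clarify)
        fix f g assume fg: "f \<in> forms i" "g \<in> forms i" "?m (residue_class I f) = ?m (residue_class I g)"
        then have "l * (f - g) \<in> I" by (simp add: A.residue_class_mult A.residue_class_eq_iff right_diff_distrib)
        then show "residue_class I f = residue_class I g"
          using inj forms_diff[OF fg(1,2)] by (simp add: A.residue_class_eq_iff)
      qed
      then show ?thesis ..
    next
      assume surj: "\<forall>g\<in>forms (Suc i). \<exists>f\<in>forms i. g - l * f \<in> I"
      have "?m ` graded_piece I i = graded_piece I (Suc i)"
        unfolding graded_piece_def image_image A.residue_class_mult
      proof (rule antisym; rule subsetI)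
        fix x assume "x \<in> (\<lambda>f. residue_class I (l * f)) ` forms i"
        then show "x \<in> residue_class I ` forms (Suc i)" using forms_one_mult[OF l] by blast
      next
        fix x assume "x \<in> residue_class I ` forms (Suc i)"
        then obtain g where g: "g \<in> forms (Suc i)" "x = residue_class I g" by blast
        then obtain f where "f \<in> forms i" "g - l * f \<in> I" using surj by blast
        then show "x \<in> (\<lambda>f. residue_class I (l * f)) ` forms i"
          using g(2) A.residue_class_eq_iff[of g "l * f"] by blast
      qed
      then show ?thesis ..
    qed
  qed
qed

end
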